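(* For every $n\geqslant 4$, the third largest (distinct) eigenvalue of the Transposition graph $T_n$ is $\frac{(n-1)(n-4)}{2}$, and its multiplicity is $\left(\frac{n(n-3)}{2}\right)^2$.
   Context: The Transposition graph $T_n$ is the Cayley graph $\mathrm{Cay}(\mathrm{Sym}_n,T)$ on the symmetric group $\mathrm{Sym}_n$, where $T$ is the set of all transpositions. Eigenvalues and multiplicities refer to its adjacency matrix. *)

theory Defs
  imports
    "HOL-Algebra.Sym_Groups"
    "Graph_Theory.Pair_Digraph"
    "Jordan_Normal_Form.Spectral_Radius"
begin

text \<open>Undirected graphs are represented by symmetric arc relations.\<close>

definition cayley_graph :: "('a, 'b) monoid_scheme \<Rightarrow> 'a set \<Rightarrow> 'a pair_pre_digraph" where
  "cayley_graph G S =
    \<lparr>pverts = carrier G,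
     parcs = {(g, h). g \<in> carrier G \<and> h \<in> carrier G \<and> (\<exists>s\<in>S. h = g \<otimes>\<^bsub>G\<^esub> s)}\<rparr>"

definition transpositions :: "nat \<Rightarrow> (nat \<Rightarrow> nat) set" where
  "transpositions n =
    {Transposition.transpose a b | a b. a \<in> {1..n} \<and> b \<in> {1..n} \<and> a \<noteq> b}"

definition transposition_graph :: "nat \<Rightarrow> (nat \<Rightarrow> nat) pair_pre_digraph" where
  "transposition_graph n = cayley_graph (sym_group n) (transpositions n)"

text \<open>Matrices are indexed by natural numbers, so the adjacency matrix depends on an
  enumeration \<open>e\<close> of the vertices.\<close>

definition vertex_enumeration :: "'a pair_pre_digraph \<Rightarrow> (nat \<Rightarrow> 'a) \<Rightarrow> bool" where
  "vertex_enumeration G e \<longleftrightarrow> bij_betw e {..<card (pverts G)} (pverts G)"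

definition adjacency_matrix :: "'a pair_pre_digraph \<Rightarrow> (nat \<Rightarrow> 'a) \<Rightarrow> real mat" where
  "adjacency_matrix G e =
    mat (card (pverts G)) (card (pverts G)) (\<lambda>(i, j). if (e i, e j) \<in> parcs G then 1 else 0)"

text \<open>The position \<open>k\<close> is counted from 1; members of the set are counted once each.\<close>

definition is_kth_largest :: "nat \<Rightarrow> real set \<Rightarrow> real \<Rightarrow> bool" where
  "is_kth_largest k S x \<longleftrightarrow>
    x \<in> S \<and> finite {y \<in> S. x < y} \<and> card {y \<in> S. x < y} + 1 = k"

definition eigenvalue_multiplicity :: "real mat \<Rightarrow> real \<Rightarrow> nat" where
  "eigenvalue_multiplicity A x = Polynomial.order x (char_poly A)"

end

theory Submission
  imports Defs
begin

text \<open>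
  Let \<open>L\<close> be the sum of \<open>1 - t\<close> over all transpositions \<open>t\<close>, acting on functions on the symmetric
  group, and let \<open>V\<^sub>k\<close> be the span of the indicators of the events \<open>p a\<^sub>1 = c\<^sub>1, \<dots>, p a\<^sub>k = c\<^sub>k\<close>. On
  \<open>V\<^sub>0\<close>, \<open>V\<^sub>1 / V\<^sub>0\<close> and \<open>V\<^sub>2 / V\<^sub>1\<close> a direct computation gives the eigenvalues \<open>0\<close>, \<open>n\<close>, and
  \<open>2n - 2\<close>, \<open>2n\<close> (on the parts symmetric and antisymmetric under swapping the two points). On the
  orthogonal complement of \<open>V\<^sub>2\<close> one has \<open>L \<ge> 2n\<close>: restricted to a coset of a point stabiliser such a
  function is orthogonal to \<open>V\<^sub>1\<close> of the smaller group, where \<open>L \<ge> 2(n - 2)\<close> by induction, and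
  averaging over the deleted point yields the factor \<open>n / (n - 2)\<close>. Hence the three smallest
  eigenvalues of \<open>L\<close> are \<open>0 < n < 2n - 2\<close>.

  With \<open>S\<close> the space of symmetric \<open>n \<times> n\<close> matrices with zero diagonal and zero row sums, of dimension
  \<open>n (n - 3) / 2\<close>, the eigenspace of \<open>2n - 2\<close> is \<open>S \<otimes> S\<close>: the tensor \<open>w \<otimes> z\<close> corresponds to the
  function \<open>p \<mapsto> \<Sum>a b. w a b * z (p a) (p b)\<close>, and pairing an eigenfunction with the indicators of
  \<open>p a = c, p b = d\<close> recovers its tensor up to positive factors.
\<close>

section \<open>Multiplicities of eigenvalues of symmetric matrices\<close>

lemma char_poly_four_block_upper_right_zero:
  fixes A D :: "'a :: idom mat"
  assumes A: "A \<in> carrier_mat n n" and C: "C \<in> carrier_mat m n" and D: "D \<in> carrier_mat m m"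
  shows "char_poly (four_block_mat A (0\<^sub>m n m) C D) = char_poly A * char_poly D"
proof -
  have "char_poly_matrix (four_block_mat A (0\<^sub>m n m) C D)
      = four_block_mat (char_poly_matrix A) (0\<^sub>m n m) (map_mat (\<lambda>a. [:- a:]) C) (char_poly_matrix D)"
    by (rule eq_matI) (use A C D in \<open>auto simp: char_poly_matrix_def one_poly_def\<close>)
  then show ?thesis
    unfolding char_poly_def
    using det_four_block_mat_upper_right_zero[OF char_poly_matrix_closed[OF A] refl,
        of "map_mat (\<lambda>a. [:- a:]) C" m "char_poly_matrix D"] C D
    by simp
qed

lemma char_poly_scalar_mat:
  "char_poly (c \<cdot>\<^sub>m 1\<^sub>m m :: 'a :: comm_ring_1 mat) = [:- c, 1:] ^ m"
proof -
  have "upper_triangular (c \<cdot>\<^sub>m 1\<^sub>m m :: 'a mat)" by auto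
  from char_poly_upper_triangular[OF _ this, of m]
  have "char_poly (c \<cdot>\<^sub>m 1\<^sub>m m) = (\<Prod>a\<leftarrow>diag_mat (c \<cdot>\<^sub>m 1\<^sub>m m). [:- a, 1:])" by simp
  also have "diag_mat (c \<cdot>\<^sub>m 1\<^sub>m m) = replicate m c"
    by (auto simp: diag_mat_def intro!: nth_equalityI)
  finally show ?thesis by (simp add: prod_list_replicate)
qed

text \<open>Conjugating the block matrix \<open>[[A - P Z, 0], [Z, \<mu>]]\<close> by \<open>[[1, - P], [0, 1]]\<close> gives
  \<open>[[A, 0], [Z, \<mu> - s]]\<close>.\<close>
lemma char_poly_eigenvalue_deflation:
  fixes A :: "'a :: idom mat"
  assumes A: "A \<in> carrier_mat N N" and P: "P \<in> carrier_mat N m" and Z: "Z \<in> carrier_mat m N"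
    and AP: "A * P = \<mu> \<cdot>\<^sub>m P" and ZP: "Z * P = s \<cdot>\<^sub>m 1\<^sub>m m"
  shows "char_poly (A - P * Z) * [:- \<mu>, 1:] ^ m = char_poly A * [:- (\<mu> - s), 1:] ^ m"
proof -
  let ?M = "four_block_mat (A - P * Z) (0\<^sub>m N m) Z (\<mu> \<cdot>\<^sub>m 1\<^sub>m m)"
  let ?M' = "four_block_mat A (0\<^sub>m N m) Z ((\<mu> - s) \<cdot>\<^sub>m 1\<^sub>m m)"
  let ?T = "four_block_mat (1\<^sub>m N) P (0\<^sub>m m N) (1\<^sub>m m)"
  let ?T' = "four_block_mat (1\<^sub>m N) (- P) (0\<^sub>m m N) (1\<^sub>m m)"
  have PZ: "P * Z \<in> carrier_mat N N" using P Z by auto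
  have one: "1\<^sub>m (N + m) = four_block_mat (1\<^sub>m N) (0\<^sub>m N m) (0\<^sub>m m N) (1\<^sub>m m :: 'a mat)"
    by (rule eq_matI) auto
  have TT': "?T * ?T' = 1\<^sub>m (N + m)" unfolding one
    by (subst mult_four_block_mat[of _ N N _ m _ m _ _ N _ m])
      (use P in \<open>auto intro!: arg_cong4[where f = four_block_mat] eq_matI\<close>)
  have T'T: "?T' * ?T = 1\<^sub>m (N + m)" unfolding one
    by (subst mult_four_block_mat[of _ N N _ m _ m _ _ N _ m])
      (use P in \<open>auto intro!: arg_cong4[where f = four_block_mat] eq_matI\<close>)
  have TM: "?T * ?M = four_block_mat A (\<mu> \<cdot>\<^sub>m P) Z (\<mu> \<cdot>\<^sub>m 1\<^sub>m m)"
    by (subst mult_four_block_mat[of _ N N _ m _ m _ _ N _ m])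
      (use A P Z PZ in \<open>auto intro!: arg_cong4[where f = four_block_mat] eq_matI\<close>)
  have M'T: "?M' * ?T = four_block_mat A (\<mu> \<cdot>\<^sub>m P) Z (\<mu> \<cdot>\<^sub>m 1\<^sub>m m)"
    by (subst mult_four_block_mat[of _ N N _ m _ m _ _ N _ m])
      (use A P Z AP ZP in \<open>auto intro!: arg_cong4[where f = four_block_mat] eq_matI\<close>)
  have M: "?M \<in> carrier_mat (N + m) (N + m)" and M': "?M' \<in> carrier_mat (N + m) (N + m)"
    and T: "?T \<in> carrier_mat (N + m) (N + m)" and T': "?T' \<in> carrier_mat (N + m) (N + m)"
    using A P Z by auto
  have "?M' = ?M' * (?T * ?T')" by (simp only: TT' right_mult_one_mat[OF M'])
  also have "\<dots> = ?T * ?M * ?T'" unfolding TM M'T[symmetric] by (rule assoc_mult_mat[OF M' T T', symmetric])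
  finally have "?M' = ?T * ?M * ?T'" .
  from similar_matI[OF _ TT' T'T this] have "similar_mat ?M' ?M" using M M' T T' by simp
  then have "char_poly ?M' = char_poly ?M" by (rule char_poly_similar)
  moreover have "char_poly ?M' = char_poly A * [:- (\<mu> - s), 1:] ^ m"
    using char_poly_four_block_upper_right_zero[OF A Z, of "(\<mu> - s) \<cdot>\<^sub>m 1\<^sub>m m"]
    by (simp add: char_poly_scalar_mat)
  moreover have "char_poly ?M = char_poly (A - P * Z) * [:- \<mu>, 1:] ^ m"
    using char_poly_four_block_upper_right_zero[OF minus_carrier_mat[OF PZ] Z, of "\<mu> \<cdot>\<^sub>m 1\<^sub>m m"]
    by (simp add: char_poly_scalar_mat)
  ultimately show ?thesis by simp
qed

text \<open>The columns of \<open>P\<close> are eigenvectors and the rows of \<open>Z\<close> are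
  functionals dual to them up to \<open>s\<close>. Subtracting \<open>P * Z\<close> moves
  \<open>m\<close> copies of \<open>\<mu>\<close> to \<open>\<mu> - s\<close>, and the hypothesis
  \<open>inj\<close> leaves no further copy behind.\<close>

lemma order_char_poly_symmetric:
  fixes A :: "real mat"
  assumes A: "A \<in> carrier_mat N N" and sym: "A\<^sup>T = A"
    and P: "P \<in> carrier_mat N m" and Z: "Z \<in> carrier_mat m N"
    and AP: "A * P = \<mu> \<cdot>\<^sub>m P" and ZP: "Z * P = s \<cdot>\<^sub>m 1\<^sub>m m" and s: "s \<noteq> 0"
    and inj: "\<And>v. v \<in> carrier_vec N \<Longrightarrow> A *\<^sub>v v = \<mu> \<cdot>\<^sub>v v \<Longrightarrow> Z *\<^sub>v v = 0\<^sub>v m \<Longrightarrow> v = 0\<^sub>v N"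
  shows "order \<mu> (char_poly A) = m"
proof -
  define B where "B = A - P * Z"
  have PZ: "P * Z \<in> carrier_mat N N" using P Z by auto
  have B: "B \<in> carrier_mat N N" using minus_carrier_mat[OF PZ] by (simp add: B_def)
  have "\<not> eigenvalue B \<mu>"
  proof
    assume "eigenvalue B \<mu>"
    then obtain v where v: "v \<in> carrier_vec N" "v \<noteq> 0\<^sub>v N" and Bv: "B *\<^sub>v v = \<mu> \<cdot>\<^sub>v v"
      using B by (auto simp: eigenvalue_def eigenvector_def)
    define u where "u = Z *\<^sub>v v"
    define r where "r = P *\<^sub>v u"
    have u: "u \<in> carrier_vec m" using Z v by (auto simp: u_def)
    have r: "r \<in> carrier_vec N" using P u by (auto simp: r_def)
    have Av: "A *\<^sub>v v \<in> carrier_vec N" using A v by auto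
    have "B *\<^sub>v v = A *\<^sub>v v - P * Z *\<^sub>v v"
      unfolding B_def using A PZ v by (simp add: minus_mult_distrib_mat_vec)
    also have "P * Z *\<^sub>v v = r" unfolding r_def u_def using P Z v by simp
    finally have eq: "A *\<^sub>v v = \<mu> \<cdot>\<^sub>v v + r"
      using Bv Av r v A B by (auto simp: vec_eq_iff)
    have Ar: "A *\<^sub>v r = \<mu> \<cdot>\<^sub>v r"
    proof -
      have "A *\<^sub>v r = A * P *\<^sub>v u" unfolding r_def using A P u by simp
      also have "\<dots> = \<mu> \<cdot>\<^sub>v r"
        unfolding AP r_def using P u by (intro eq_vecI) auto
      finally show ?thesis .
    qed
    \<comment> \<open>Here \<open>r\<close> is the value of \<open>A - \<mu>\<close> at
      \<open>v\<close> and also lies in its kernel. Symmetry of \<open>A\<close> rules out such a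
      Jordan chain: pairing with \<open>v\<close> in both ways yields
      \<open>r \<bullet> r = 0\<close>.\<close>
    have "(A *\<^sub>v r) \<bullet> v = r \<bullet> (A *\<^sub>v v)"
      using transpose_vec_mult_scalar[OF A v(1) r] by (simp add: sym)
    then have "\<mu> * (r \<bullet> v) = \<mu> * (r \<bullet> v) + r \<bullet> r"
      unfolding Ar eq using r v by (simp add: scalar_prod_add_distrib[of _ N])
    then have "r \<bullet> r = 0" by simp
    then have r0: "r = 0\<^sub>v N" using r conjugate_square_eq_0_vec[of r N] by simp
    have "Z *\<^sub>v r = Z * P *\<^sub>v u" unfolding r_def using Z P u by simp
    also have "\<dots> = s \<cdot>\<^sub>v u" unfolding ZP using u by (intro eq_vecI) auto
    finally have "s \<cdot>\<^sub>v u = Z *\<^sub>v r" ..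
    also have "\<dots> = 0\<^sub>v m" unfolding r0 using Z by (intro eq_vecI) auto
    finally have "s \<cdot>\<^sub>v u = 0\<^sub>v m" .
    then have "u = 0\<^sub>v m" using u s by (auto simp: vec_eq_iff)
    moreover have "A *\<^sub>v v = \<mu> \<cdot>\<^sub>v v" using eq r0 v by simp
    ultimately show False using inj[OF v(1)] v(2) by (simp add: u_def)
  qed
  then have B0: "poly (char_poly B) \<mu> \<noteq> 0" using eigenvalue_root_char_poly[OF B] by simp
  have nz: "char_poly A \<noteq> 0" "char_poly B \<noteq> 0"
    using degree_monic_char_poly[OF A] degree_monic_char_poly[OF B] by auto
  have s0: "poly ([:- (\<mu> - s), 1:] ^ m) \<mu> \<noteq> 0" using s by simp
  \<comment> \<open>Compare the order of \<open>\<mu>\<close> on both sides: it is no root of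
    \<open>char_poly B\<close>, and no root of the power on the right because \<open>s\<close> is
    nonzero.\<close>
  have eq: "char_poly B * [:- \<mu>, 1:] ^ m = char_poly A * [:- (\<mu> - s), 1:] ^ m"
    unfolding B_def by (rule char_poly_eigenvalue_deflation[OF A P Z AP ZP])
  have "order \<mu> (char_poly B * [:- \<mu>, 1:] ^ m) = order \<mu> (char_poly B) + order \<mu> ([:- \<mu>, 1:] ^ m)"
    by (rule order_mult) (simp add: nz)
  moreover have "order \<mu> (char_poly B) = 0" by (rule order_0I[OF B0])
  moreover have "order \<mu> ([:- \<mu>, 1:] ^ m) = m" by (rule order_power_n_n)
  moreover have "order \<mu> (char_poly A * [:- (\<mu> - s), 1:] ^ m)
      = order \<mu> (char_poly A) + order \<mu> ([:- (\<mu> - s), 1:] ^ m)"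
    by (rule order_mult) (simp add: nz)
  moreover have "order \<mu> ([:- (\<mu> - s), 1:] ^ m) = 0" by (rule order_0I[OF s0])
  ultimately show ?thesis using eq by simp
qed

section \<open>The Laplacian on functions on permutations\<close>

definition inner_on :: "'a set \<Rightarrow> ('a \<Rightarrow> real) \<Rightarrow> ('a \<Rightarrow> real) \<Rightarrow> real" where
  "inner_on S f g = (\<Sum>x\<in>S. f x * g x)"

lemma inner_on_commute: "inner_on S f g = inner_on S g f"
  by (simp add: inner_on_def mult.commute)

lemma inner_on_add_left: "inner_on S (\<lambda>x. f x + g x) h = inner_on S f h + inner_on S g h"
  by (simp add: inner_on_def algebra_simps sum.distrib)

lemma inner_on_add_right: "inner_on S h (\<lambda>x. f x + g x) = inner_on S h f + inner_on S h g"
  by (simp add: inner_on_def algebra_simps sum.distrib)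

lemma inner_on_diff_left: "inner_on S (\<lambda>x. f x - g x) h = inner_on S f h - inner_on S g h"
  by (simp add: inner_on_def algebra_simps sum_subtractf)

lemma inner_on_diff_right: "inner_on S h (\<lambda>x. f x - g x) = inner_on S h f - inner_on S h g"
  by (simp add: inner_on_def algebra_simps sum_subtractf)

lemma inner_on_scale_left: "inner_on S (\<lambda>x. c * f x) h = c * inner_on S f h"
  by (simp add: inner_on_def sum_distrib_left mult.assoc)

lemma inner_on_scale_right: "inner_on S h (\<lambda>x. c * f x) = c * inner_on S h f"
  by (simp add: inner_on_def sum_distrib_left algebra_simps)

lemma inner_on_sum_right:
  "inner_on S h (\<lambda>x. \<Sum>k\<in>K. f k x) = (\<Sum>k\<in>K. inner_on S h (f k))"
  unfolding inner_on_def sum_distrib_left by (rule sum.swap)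

lemmas inner_on_linear = inner_on_add_left inner_on_add_right inner_on_diff_left inner_on_diff_right
  inner_on_scale_left inner_on_scale_right

lemma inner_on_cong_left: "(\<And>x. x \<in> S \<Longrightarrow> f x = f' x) \<Longrightarrow> inner_on S f g = inner_on S f' g"
  by (simp add: inner_on_def)

lemma inner_on_cong_right: "(\<And>x. x \<in> S \<Longrightarrow> g x = g' x) \<Longrightarrow> inner_on S f g = inner_on S f g'"
  by (simp add: inner_on_def)

lemma inner_on_nonneg: "inner_on S f f \<ge> 0"
  by (simp add: inner_on_def sum_nonneg)

lemma inner_on_eq_0_iff: "finite S \<Longrightarrow> inner_on S f f = 0 \<longleftrightarrow> (\<forall>x\<in>S. f x = 0)"
  by (simp add: inner_on_def sum_nonneg_eq_0_iff)

text \<open>That \<open>p\<close> lies in the span of \<open>B\<close> is expressed by orthogonality to everything that is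
  orthogonal to \<open>B\<close>.\<close>
lemma orthogonal_projection_exists:
  assumes S: "finite S" and B: "finite B"
  shows "\<exists>p. (\<forall>b\<in>B. inner_on S (\<lambda>x. f x - p x) b = 0) \<and>
             (\<forall>q. (\<forall>b\<in>B. inner_on S q b = 0) \<longrightarrow> inner_on S p q = 0)"
  using B
proof (induction B arbitrary: f rule: finite_induct)
  case empty
  show ?case by (intro exI[of _ "\<lambda>_. 0"]) (simp add: inner_on_def)
next
  case (insert b B)
  obtain pf where pf: "\<forall>c\<in>B. inner_on S (\<lambda>x. f x - pf x) c = 0"
      "\<And>q. \<forall>c\<in>B. inner_on S q c = 0 \<Longrightarrow> inner_on S pf q = 0"
    using insert.IH[of f] by blast
  obtain pb where pb: "\<forall>c\<in>B. inner_on S (\<lambda>x. b x - pb x) c = 0"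
      "\<And>q. \<forall>c\<in>B. inner_on S q c = 0 \<Longrightarrow> inner_on S pb q = 0"
    using insert.IH[of b] by blast
  \<comment> \<open>Gram-Schmidt: \<open>b'\<close> is the part of \<open>b\<close> orthogonal to
    \<open>B\<close>. If it vanishes on \<open>S\<close>, then \<open>b\<close> adds nothing to the
    span and \<open>pf\<close> still serves; otherwise the component of \<open>f\<close> along
    \<open>b'\<close> is added.\<close>
  define b' where "b' = (\<lambda>x. b x - pb x)"
  have b: "b = (\<lambda>x. b' x + pb x)" by (simp add: b'_def)
  have b'B: "\<forall>c\<in>B. inner_on S b' c = 0" using pb(1) by (simp add: b'_def)
  show ?case
  proof (cases "inner_on S b' b' = 0")
    case True
    then have "\<And>g. inner_on S g b' = 0"
      using S by (simp add: inner_on_eq_0_iff) (simp add: inner_on_def)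
    then have "inner_on S (\<lambda>x. f x - pf x) b = 0"
      using pb(2)[OF pf(1)] by (subst b) (simp only: inner_on_add_right inner_on_commute[of S _ pb])
    then show ?thesis using pf by (intro exI[of _ pf]) auto
  next
    case False
    define l where "l = inner_on S f b' / inner_on S b' b'"
    define p where "p = (\<lambda>x. pf x + l * b' x)"
    have lb: "l * inner_on S b' b' = inner_on S f b'" using False by (simp add: l_def)
    have pB: "\<forall>c\<in>B. inner_on S (\<lambda>x. f x - p x) c = 0"
      using pf(1) b'B by (simp add: p_def inner_on_linear)
    have "inner_on S (\<lambda>x. f x - p x) b' = 0"
      using pf(2)[OF b'B] lb by (simp add: p_def inner_on_linear)
    then have "inner_on S (\<lambda>x. f x - p x) b = 0"
      using pb(2)[OF pB] by (subst b) (simp only: inner_on_add_right inner_on_commute[of S _ pb])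
    moreover have "inner_on S p q = 0" if "\<forall>c\<in>insert b B. inner_on S q c = 0" for q
    proof -
      have qB: "\<forall>c\<in>B. inner_on S q c = 0" and qb: "inner_on S b q = 0"
        using that by (auto simp: inner_on_commute)
      show ?thesis using pf(2)[OF qB] pb(2)[OF qB] qb by (simp add: p_def b'_def inner_on_linear)
    qed
    ultimately show ?thesis using pB by (intro exI[of _ p]) auto
  qed
qed

section \<open>The Laplacian and its action on the indicators\<close>

abbreviation perms :: "'a set \<Rightarrow> ('a \<Rightarrow> 'a) set" where
  "perms I \<equiv> {p. p permutes I}"

abbreviation ip :: "'a set \<Rightarrow> (('a \<Rightarrow> 'a) \<Rightarrow> real) \<Rightarrow> (('a \<Rightarrow> 'a) \<Rightarrow> real) \<Rightarrow> real" where
  "ip I \<equiv> inner_on (perms I)"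

text \<open>The sum runs over ordered pairs, so \<open>lap\<close> is twice the operator \<open>L\<close> above.\<close>
definition lap :: "'a set \<Rightarrow> (('a \<Rightarrow> 'a) \<Rightarrow> real) \<Rightarrow> ('a \<Rightarrow> 'a) \<Rightarrow> real" where
  "lap I f p = (\<Sum>i\<in>I. \<Sum>j\<in>I. f p - f (p \<circ> Transposition.transpose i j))"

definition fix1 :: "'a \<Rightarrow> 'a \<Rightarrow> ('a \<Rightarrow> 'a) \<Rightarrow> real" where
  "fix1 a c p = of_bool (p a = c)"

definition fix2 :: "'a \<Rightarrow> 'a \<Rightarrow> 'a \<Rightarrow> 'a \<Rightarrow> ('a \<Rightarrow> 'a) \<Rightarrow> real" where
  "fix2 a b c d p = of_bool (p a = c \<and> p b = d)"

lemma sum_perms_transpose_right: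
  assumes "i \<in> I" "j \<in> I"
  shows "(\<Sum>p\<in>perms I. F (p \<circ> Transposition.transpose i j)) = (\<Sum>p\<in>perms I. F p)"
  by (rule sum.reindex_bij_witness[where i = "\<lambda>p. p \<circ> Transposition.transpose i j"
        and j = "\<lambda>p. p \<circ> Transposition.transpose i j"])
    (use assms in \<open>auto simp: o_assoc[symmetric] intro!: permutes_compose permutes_swap_id\<close>)

lemma ip_lap:
  "ip I (lap I f) g = (\<Sum>i\<in>I. \<Sum>j\<in>I. \<Sum>p\<in>perms I. (f p - f (p \<circ> Transposition.transpose i j)) * g p)"
proof -
  have "ip I (lap I f) g
      = (\<Sum>p\<in>perms I. \<Sum>i\<in>I. \<Sum>j\<in>I. (f p - f (p \<circ> Transposition.transpose i j)) * g p)"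
    by (simp add: inner_on_def lap_def sum_distrib_right)
  also have "\<dots> = (\<Sum>i\<in>I. \<Sum>p\<in>perms I. \<Sum>j\<in>I. (f p - f (p \<circ> Transposition.transpose i j)) * g p)"
    by (rule sum.swap)
  also have "\<dots> = (\<Sum>i\<in>I. \<Sum>j\<in>I. \<Sum>p\<in>perms I. (f p - f (p \<circ> Transposition.transpose i j)) * g p)"
    by (intro sum.cong refl sum.swap)
  finally show ?thesis .
qed

text \<open>Right multiplication by a transposition is an involution of the group, so every summand
  of \<open>lap\<close> is self-adjoint.\<close>

lemma ip_lap_commute: "ip I (lap I f) g = ip I f (lap I g)"
proof -
  have "(\<Sum>p\<in>perms I. (f p - f (p \<circ> Transposition.transpose i j)) * g p)
      = (\<Sum>p\<in>perms I. (g p - g (p \<circ> Transposition.transpose i j)) * f p)" if "i \<in> I" "j \<in> I" for i j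
    using sum_perms_transpose_right[OF that, of "\<lambda>p. f p * g (p \<circ> Transposition.transpose i j)"]
    by (simp add: algebra_simps sum_subtractf o_assoc[symmetric])
  then have "ip I (lap I f) g = ip I (lap I g) f" unfolding ip_lap by simp
  then show ?thesis by (simp add: inner_on_commute)
qed

text \<open>This is the Dirichlet form: when the square is expanded, both square terms have the same
  sum over the group.\<close>

lemma lap_quadratic_form:
  "2 * ip I (lap I f) f = (\<Sum>i\<in>I. \<Sum>j\<in>I. \<Sum>p\<in>perms I. (f p - f (p \<circ> Transposition.transpose i j))\<^sup>2)"
proof -
  have "2 * (\<Sum>p\<in>perms I. (f p - f (p \<circ> Transposition.transpose i j)) * f p)
      = (\<Sum>p\<in>perms I. (f p - f (p \<circ> Transposition.transpose i j))\<^sup>2)" if "i \<in> I" "j \<in> I" for i j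
    using sum_perms_transpose_right[OF that, of "\<lambda>p. f p * f p"]
    by (simp add: power2_eq_square algebra_simps sum_subtractf sum.distrib sum_distrib_left)
  then show ?thesis unfolding ip_lap by (simp add: sum_distrib_left)
qed

lemma lap_nonneg: "ip I (lap I f) f \<ge> 0"
  using lap_quadratic_form[of I f] by (smt (verit) sum_nonneg zero_le_power2)

lemma lap_diff: "lap I (\<lambda>p. f p - g p) = (\<lambda>p. lap I f p - lap I g p)"
  by (simp add: lap_def fun_eq_iff sum_subtractf algebra_simps sum.distrib)

text \<open>Only pairs containing \<open>a\<close> contribute, and every other point
  \<open>k\<close> is reached twice, through \<open>(a, k)\<close> and
  \<open>(k, a)\<close>.\<close>

lemma sum_transpose_single:
  fixes G :: "'a \<Rightarrow> real"
  assumes I: "finite I" and a: "a \<in> I"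
  shows "(\<Sum>i\<in>I. \<Sum>j\<in>I. G a - G (Transposition.transpose i j a))
    = 2 * (real (card I) * G a - (\<Sum>k\<in>I. G k))"
proof -
  define K where "K = I - {a}"
  have K: "I = insert a K" "a \<notin> K" "finite K" using I a by (auto simp: K_def)
  have 1: "(\<Sum>j\<in>K. G a - G (Transposition.transpose a j a)) = card K * G a - sum G K"
    using K by (simp add: sum_subtractf)
  have "Transposition.transpose i j a = a" if "i \<in> K" "j \<in> K" for i j
    using that K by (metis transpose_apply_other)
  then have 2: "(\<Sum>j\<in>K. G a - G (Transposition.transpose i j a)) = 0" if "i \<in> K" for i
    using that by simp
  have "(\<Sum>i\<in>I. \<Sum>j\<in>I. G a - G (Transposition.transpose i j a))
      = (\<Sum>j\<in>K. G a - G (Transposition.transpose a j a))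
        + (\<Sum>i\<in>K. G a - G i + (\<Sum>j\<in>K. G a - G (Transposition.transpose i j a)))"
    unfolding K(1) using K(2,3) by simp
  also have "\<dots> = card K * G a - sum G K + (\<Sum>i\<in>K. G a - G i)"
    using 1 2 by simp
  finally show ?thesis unfolding K(1) using K(2,3) by (simp add: sum_subtractf algebra_simps)
qed

text \<open>The pairs \<open>(i, j)\<close> are sorted by how they meet \<open>{a, b}\<close>: the
  swap of \<open>a\<close> and \<open>b\<close> gives \<open>G b a\<close>, moving \<open>a\<close>
  alone gives \<open>G k b\<close>, moving \<open>b\<close> alone gives \<open>G a k\<close>, each
  in two orders. The terms \<open>G b b\<close> and \<open>G a a\<close> compensate for extending
  the sums over \<open>k\<close> to all of \<open>I\<close>.\<close>

lemma sum_transpose_pair: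
  fixes G :: "'a \<Rightarrow> 'a \<Rightarrow> real"
  assumes I: "finite I" and ab: "a \<in> I" "b \<in> I" "a \<noteq> b"
  shows "(\<Sum>i\<in>I. \<Sum>j\<in>I. G a b - G (Transposition.transpose i j a) (Transposition.transpose i j b))
    = 2 * ((2 * real (card I) - 1) * G a b - G b a - (\<Sum>k\<in>I. G k b) - (\<Sum>k\<in>I. G a k) + G b b + G a a)"
proof -
  define K where "K = I - {a, b}"
  have K: "I = insert a (insert b K)" "a \<notin> K" "b \<notin> K" "finite K" using I ab by (auto simp: K_def)
  let ?s = "\<lambda>i j. G a b - G (Transposition.transpose i j a) (Transposition.transpose i j b)"
  have other: "Transposition.transpose i j x = x" if "x \<noteq> i" "x \<noteq> j" for i j x :: 'a
    using that by (metis transpose_apply_other)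
  have 1: "(\<Sum>j\<in>K. ?s a j) = card K * G a b - (\<Sum>k\<in>K. G k b)"
  proof -
    have "(\<Sum>j\<in>K. ?s a j) = (\<Sum>j\<in>K. G a b - G j b)"
      using K ab other by (intro sum.cong refl) (metis transpose_apply_first)
    then show ?thesis using K by (simp add: sum_subtractf)
  qed
  have 2: "(\<Sum>j\<in>K. ?s b j) = card K * G a b - (\<Sum>k\<in>K. G a k)"
  proof -
    have "(\<Sum>j\<in>K. ?s b j) = (\<Sum>j\<in>K. G a b - G a j)"
      using K ab other by (intro sum.cong refl) (metis transpose_apply_first)
    then show ?thesis using K by (simp add: sum_subtractf)
  qed
  have 3: "(\<Sum>j\<in>K. ?s i j) = 0" if "i \<in> K" for i
  proof (intro sum.neutral ballI)
    fix j assume "j \<in> K"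
    then show "?s i j = 0" using that K other[of a i j] other[of b i j] by (metis diff_self)
  qed
  have 4: "?s i a = G a b - G i b" "?s i b = G a b - G a i" if "i \<in> K" for i
  proof -
    have "i \<noteq> a" "i \<noteq> b" using that K by auto
    then have "Transposition.transpose i a b = b" "Transposition.transpose i b a = a"
      using ab(3) other by metis+
    then show "?s i a = G a b - G i b" "?s i b = G a b - G a i" by simp_all
  qed
  have "(\<Sum>i\<in>I. \<Sum>j\<in>I. ?s i j)
      = (\<Sum>j\<in>I. ?s a j) + (\<Sum>j\<in>I. ?s b j) + (\<Sum>i\<in>K. \<Sum>j\<in>I. ?s i j)"
    by (subst K(1)) (use K(2-) ab(3) in simp)
  also have "(\<Sum>j\<in>I. ?s a j) = G a b - G b a + card K * G a b - (\<Sum>k\<in>K. G k b)"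
    unfolding K(1) using K(2-) ab(3) 1 by simp
  also have "(\<Sum>j\<in>I. ?s b j) = G a b - G b a + card K * G a b - (\<Sum>k\<in>K. G a k)"
    unfolding K(1) using K(2-) ab(3) 2 by simp
  also have "(\<Sum>i\<in>K. \<Sum>j\<in>I. ?s i j) = (\<Sum>i\<in>K. (G a b - G i b) + (G a b - G a i))"
  proof (intro sum.cong refl)
    fix i assume i: "i \<in> K"
    have "(\<Sum>j\<in>I. ?s i j) = ?s i a + (?s i b + (\<Sum>j\<in>K. ?s i j))"
      unfolding K(1) using K(2-) ab(3) by simp
    then show "(\<Sum>j\<in>I. ?s i j) = (G a b - G i b) + (G a b - G a i)"
      using 3[OF i] 4[OF i] by simp
  qed
  also have "\<dots> = 2 * card K * G a b - (\<Sum>k\<in>K. G k b) - (\<Sum>k\<in>K. G a k)"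
    by (simp add: sum_subtractf sum.distrib sum_negf)
  finally have "(\<Sum>i\<in>I. \<Sum>j\<in>I. ?s i j) = G a b - G b a + card K * G a b - (\<Sum>k\<in>K. G k b)
      + (G a b - G b a + card K * G a b - (\<Sum>k\<in>K. G a k))
      + (2 * card K * G a b - (\<Sum>k\<in>K. G k b) - (\<Sum>k\<in>K. G a k))" .
  moreover have "real (card I) = 2 + real (card K)" unfolding K(1) using K(2-) ab(3) by simp
  moreover have "(\<Sum>k\<in>I. G k b) = G a b + G b b + (\<Sum>k\<in>K. G k b)"
    unfolding K(1) using K(2-) ab(3) by simp
  moreover have "(\<Sum>k\<in>I. G a k) = G a a + G a b + (\<Sum>k\<in>K. G a k)"
    unfolding K(1) using K(2-) ab(3) by simp
  ultimately show ?thesis by (simp only:) (simp add: algebra_simps)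
qed

lemma sum_fix1_source:
  assumes "finite I" "c \<in> I" "p permutes I"
  shows "(\<Sum>k\<in>I. fix1 k c p) = 1"
proof -
  have "(\<Sum>k\<in>I. fix1 k c p) = (\<Sum>k\<in>I. of_bool (k = inv_into UNIV p c))"
    using assms by (intro sum.cong refl) (auto simp: fix1_def permutes_inverses)
  then show ?thesis using assms permutes_in_image[OF permutes_inv[OF assms(3)]] by simp
qed

lemma sum_fix1_target:
  assumes "finite I" "a \<in> I" "p permutes I"
  shows "(\<Sum>c\<in>I. fix1 a c p) = 1"
  using assms permutes_in_image[OF assms(3)] by (simp add: fix1_def of_bool_def)

lemma sum_fix2_first:
  assumes "finite I" "c \<in> I" "p permutes I"
  shows "(\<Sum>k\<in>I. fix2 k b c d p) = fix1 b d p"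
proof -
  have "(\<Sum>k\<in>I. fix2 k b c d p) = (\<Sum>k\<in>I. fix1 k c p) * fix1 b d p"
    unfolding sum_distrib_right by (simp add: fix2_def fix1_def of_bool_conj)
  then show ?thesis using sum_fix1_source[OF assms] by simp
qed

lemma fix2_swap: "fix2 a b c d = fix2 b a d c"
  by (auto simp: fix2_def fun_eq_iff)

lemma sum_fix2_second:
  assumes "finite I" "d \<in> I" "p permutes I"
  shows "(\<Sum>k\<in>I. fix2 a k c d p) = fix1 a c p"
  using sum_fix2_first[OF assms] by (subst fix2_swap)

lemma fix2_diagonal: "fix2 a a c c = fix1 a c"
  by (simp add: fix2_def fix1_def fun_eq_iff)

lemma ip_fix2_eq_0:
  assumes "(a = b) \<noteq> (c = d)"
  shows "ip I f (fix2 a b c d) = 0"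
proof -
  have "fix2 a b c d p = 0" if "p permutes I" for p
    using assms permutes_inj[OF that] by (auto simp: fix2_def inj_def)
  then show ?thesis by (simp add: inner_on_def)
qed

text \<open>Composing \<open>p\<close> with a transposition on the right moves the point
  \<open>a\<close> and leaves the value \<open>c\<close> alone, so this is
  \<open>sum_transpose_single\<close> for \<open>fix1\<close> as a function of its first
  index.\<close>

lemma lap_fix1:
  assumes "finite I" "a \<in> I" "c \<in> I" "p permutes I"
  shows "lap I (fix1 a c) p = 2 * (real (card I) * fix1 a c p - 1)"
  using sum_transpose_single[OF assms(1,2), of "\<lambda>k. fix1 k c p"] sum_fix1_source[OF assms(1,3,4)]
  by (simp add: lap_def fix1_def)

lemma lap_fix2:
  assumes "finite I" "a \<in> I" "b \<in> I" "c \<in> I" "d \<in> I" "a \<noteq> b" "c \<noteq> d" "p permutes I"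
  shows "lap I (fix2 a b c d) p
    = 2 * ((2 * real (card I) - 1) * fix2 a b c d p - fix2 b a c d p - fix1 a c p - fix1 b d p)"
proof -
  have "fix2 a a c d p = 0" "fix2 b b c d p = 0" using assms(7) by (auto simp: fix2_def)
  then show ?thesis
    using sum_transpose_pair[OF assms(1,2,3,6), of "\<lambda>a b. fix2 a b c d p"]
      sum_fix2_first[OF assms(1,4,8), of b d] sum_fix2_second[OF assms(1,5,8), of a c]
    by (simp add: lap_def fix2_def)
qed

lemma ip_lap_one: "ip I (lap I f) (\<lambda>_. 1) = 0"
  unfolding ip_lap_commute by (simp add: lap_def inner_on_def)

text \<open>Self-adjointness moves \<open>lap\<close> onto the indicator. Eigenvalues are later read
  off from these relations between pairings.\<close>

lemma ip_lap_fix1: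
  assumes "finite I" "a \<in> I" "c \<in> I"
  shows "ip I (lap I f) (fix1 a c) = 2 * (real (card I) * ip I f (fix1 a c) - ip I f (\<lambda>_. 1))"
proof -
  have "ip I (lap I f) (fix1 a c) = ip I f (\<lambda>p. 2 * (real (card I) * fix1 a c p - 1))"
    unfolding ip_lap_commute using assms by (intro inner_on_cong_right) (simp add: lap_fix1)
  then show ?thesis by (simp only: inner_on_linear)
qed

lemma ip_lap_fix2:
  assumes "finite I" "a \<in> I" "b \<in> I" "c \<in> I" "d \<in> I" "a \<noteq> b" "c \<noteq> d"
  shows "ip I (lap I f) (fix2 a b c d)
    = 2 * ((2 * real (card I) - 1) * ip I f (fix2 a b c d) - ip I f (fix2 b a c d)
           - ip I f (fix1 a c) - ip I f (fix1 b d))"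
proof -
  have "ip I (lap I f) (fix2 a b c d) = ip I f (\<lambda>p. 2 * ((2 * real (card I) - 1) * fix2 a b c d p
      - fix2 b a c d p - fix1 a c p - fix1 b d p))"
    unfolding ip_lap_commute using assms by (intro inner_on_cong_right) (simp add: lap_fix2)
  then show ?thesis by (simp add: inner_on_linear)
qed

section \<open>Orthogonal complements of V_1 and V_2\<close>

definition perp1 :: "'a set \<Rightarrow> (('a \<Rightarrow> 'a) \<Rightarrow> real) \<Rightarrow> bool" where
  "perp1 I f \<longleftrightarrow> (\<forall>a\<in>I. \<forall>c\<in>I. ip I f (fix1 a c) = 0)"

text \<open>The spans V_1 and V_2 never appear as objects, only their complements. The case
  \<open>a = b\<close>, \<open>c = d\<close> is included so that \<open>perp2\<close> implies
  \<open>perp1\<close>.\<close>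

definition perp2 :: "'a set \<Rightarrow> (('a \<Rightarrow> 'a) \<Rightarrow> real) \<Rightarrow> bool" where
  "perp2 I f \<longleftrightarrow> (\<forall>a\<in>I. \<forall>b\<in>I. \<forall>c\<in>I. \<forall>d\<in>I. ip I f (fix2 a b c d) = 0)"

lemma perp1D: "perp1 I f \<Longrightarrow> a \<in> I \<Longrightarrow> c \<in> I \<Longrightarrow> ip I f (fix1 a c) = 0"
  by (simp add: perp1_def)

lemma perp2D:
  "perp2 I f \<Longrightarrow> a \<in> I \<Longrightarrow> b \<in> I \<Longrightarrow> c \<in> I \<Longrightarrow> d \<in> I \<Longrightarrow> ip I f (fix2 a b c d) = 0"
  by (simp add: perp2_def)

lemma perp2_imp_perp1: "perp2 I f \<Longrightarrow> perp1 I f"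
  unfolding perp1_def using perp2D[of I f] by (metis fix2_diagonal)

lemma perp1_diff: "perp1 I f \<Longrightarrow> perp1 I g \<Longrightarrow> perp1 I (\<lambda>p. f p - g p)"
  by (simp add: perp1_def inner_on_linear)

lemma perp1_scale: "perp1 I f \<Longrightarrow> perp1 I (\<lambda>p. c * f p)"
  by (simp add: perp1_def inner_on_linear)

lemma perp1_ip_one:
  assumes "finite I" "a \<in> I" "perp1 I f"
  shows "ip I f (\<lambda>_. 1) = 0"
proof -
  have "ip I f (\<lambda>_. 1) = ip I f (\<lambda>p. \<Sum>c\<in>I. fix1 a c p)"
    using assms by (intro inner_on_cong_right) (simp add: sum_fix1_target)
  also have "\<dots> = 0" using assms by (simp add: inner_on_sum_right perp1D)
  finally show ?thesis .
qed

lemma perp1_lap: "finite I \<Longrightarrow> perp1 I f \<Longrightarrow> perp1 I (lap I f)"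
  unfolding perp1_def using perp1_ip_one[of I _ f] by (auto simp: ip_lap_fix1 perp1_def)

lemma perp2I:
  assumes "perp1 I f"
    and "\<And>a b c d. a \<in> I \<Longrightarrow> b \<in> I \<Longrightarrow> c \<in> I \<Longrightarrow> d \<in> I \<Longrightarrow> a \<noteq> b \<Longrightarrow> c \<noteq> d \<Longrightarrow> ip I f (fix2 a b c d) = 0"
  shows "perp2 I f"
  unfolding perp2_def
proof (intro ballI)
  fix a b c d assume *: "a \<in> I" "b \<in> I" "c \<in> I" "d \<in> I"
  consider "(a = b) \<noteq> (c = d)" | "a = b" "c = d" | "a \<noteq> b" "c \<noteq> d" by blast
  then show "ip I f (fix2 a b c d) = 0"
  proof cases
    case 1
    then show ?thesis by (rule ip_fix2_eq_0)
  next
    case 2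
    then show ?thesis using perp1D[OF assms(1)] * by (simp add: fix2_diagonal)
  next
    case 3
    then show ?thesis using assms(2) * by blast
  qed
qed

lemma perp2_lap:
  assumes I: "finite I" and f: "perp2 I f"
  shows "perp2 I (lap I f)"
proof (rule perp2I)
  show "perp1 I (lap I f)" using I f by (intro perp1_lap perp2_imp_perp1)
qed (use I perp2D[OF f] perp1D[OF perp2_imp_perp1[OF f]] in \<open>simp add: ip_lap_fix2\<close>)

text \<open>With \<open>n = card I\<close>, the shift \<open>4 n - 2\<close> is the midpoint of the
  values \<open>4 n - 4\<close> and \<open>4 n\<close> that \<open>lap\<close> takes on V_2 modulo
  V_1. There the shifted operator is \<open>- 2\<close> times the swap of the two points.\<close>

definition shifted_lap :: "'a set \<Rightarrow> (('a \<Rightarrow> 'a) \<Rightarrow> real) \<Rightarrow> ('a \<Rightarrow> 'a) \<Rightarrow> real" where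
  "shifted_lap I f = (\<lambda>p. lap I f p - (4 * real (card I) - 2) * f p)"

lemma ip_shifted_lap_commute: "ip I (shifted_lap I f) g = ip I f (shifted_lap I g)"
  by (simp add: shifted_lap_def inner_on_linear ip_lap_commute)

lemma perp1_shifted_lap: "finite I \<Longrightarrow> perp1 I f \<Longrightarrow> perp1 I (shifted_lap I f)"
  unfolding shifted_lap_def by (intro perp1_diff perp1_scale perp1_lap)

lemma ip_shifted_lap_fix2:
  assumes "finite I" "perp1 I f" "a \<in> I" "b \<in> I" "c \<in> I" "d \<in> I" "a \<noteq> b" "c \<noteq> d"
  shows "ip I (shifted_lap I f) (fix2 a b c d) = - 2 * ip I f (fix2 b a c d)"
  using assms perp1D[OF assms(2)]
  by (simp add: shifted_lap_def inner_on_linear ip_lap_fix2)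

text \<open>Swapping the two points twice is the identity, so the factor \<open>- 2\<close> squares
  to \<open>4\<close>.\<close>

lemma perp2_shifted_lap_square:
  assumes I: "finite I" and f: "perp1 I f"
  shows "perp2 I (\<lambda>p. shifted_lap I (shifted_lap I f) p - 4 * f p)"
proof (rule perp2I)
  show "perp1 I (\<lambda>p. shifted_lap I (shifted_lap I f) p - 4 * f p)"
    by (intro perp1_diff perp1_scale perp1_shifted_lap I f)
qed (use I f perp1_shifted_lap[OF I f] in \<open>simp add: inner_on_linear ip_shifted_lap_fix2\<close>)

text \<open>Split \<open>f = p + q\<close> with \<open>p\<close> in V_2 and \<open>q\<close>
  orthogonal to V_2. The cross terms vanish because \<open>lap\<close> preserves
  \<open>perp2\<close>. The bound for \<open>q\<close> is the hypothesis \<open>gap\<close>; on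
  \<open>p\<close> the shifted operator squares to \<open>4\<close>, hence is at least
  \<open>- 2\<close>.\<close>

lemma perp1_gap_if_perp2_gap:
  assumes I: "finite I" and f: "perp1 I f"
    and gap: "\<And>q. perp2 I q \<Longrightarrow> ip I (lap I q) q \<ge> 4 * real (card I) * ip I q q"
  shows "ip I (lap I f) f \<ge> 4 * (real (card I) - 1) * ip I f f"
proof -
  let ?n = "real (card I)"
  define B where "B = (\<lambda>(a, b, c, d). fix2 a b c d) ` (I \<times> I \<times> I \<times> I)"
  have B: "(\<forall>b\<in>B. ip I h b = 0) \<longleftrightarrow> perp2 I h" for h
    unfolding B_def perp2_def by auto
  have "finite (perms I)" "finite B" using I by (auto simp: finite_permutations B_def)
  from orthogonal_projection_exists[OF this, of f] obtain p where
    q: "perp2 I (\<lambda>x. f x - p x)" and p: "\<And>h. perp2 I h \<Longrightarrow> ip I p h = 0"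
    unfolding B by blast
  define q where "q = (\<lambda>x. f x - p x)"
  have q2: "perp2 I q" using q by (simp add: q_def)
  have f_eq: "f = (\<lambda>x. p x + q x)" by (simp add: q_def)
  have p_eq: "p = (\<lambda>x. f x - q x)" by (simp add: q_def)
  have p1: "perp1 I p" by (subst p_eq) (intro perp1_diff f perp2_imp_perp1 q2)
  have pq: "ip I p q = 0" "ip I q p = 0" using p[OF q2] by (simp_all add: inner_on_commute)
  have lpq: "ip I (lap I p) q = 0" using p[OF perp2_lap[OF I q2]] by (simp add: ip_lap_commute)
  have lqp: "ip I (lap I q) p = 0" using p[OF perp2_lap[OF I q2]] by (simp add: inner_on_commute)
  \<comment> \<open>The square of the shifted operator agrees with \<open>4\<close> on
    \<open>p\<close> only up to a function in \<open>perp2\<close>, and \<open>p\<close> is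
    orthogonal to that error.\<close>
  have TT: "ip I (shifted_lap I p) (shifted_lap I p) = 4 * ip I p p"
    using p[OF perp2_shifted_lap_square[OF I p1]]
    by (simp add: inner_on_linear flip: ip_shifted_lap_commute[of I p])
  have "0 \<le> ip I (\<lambda>x. shifted_lap I p x + 2 * p x) (\<lambda>x. shifted_lap I p x + 2 * p x)"
    by (rule inner_on_nonneg)
  also have "\<dots> = 8 * ip I p p + 4 * ip I (shifted_lap I p) p"
    using TT by (simp add: inner_on_linear inner_on_commute[of _ p "shifted_lap I p"])
  also have "ip I (shifted_lap I p) p = ip I (lap I p) p - (4 * ?n - 2) * ip I p p"
    by (simp add: shifted_lap_def inner_on_linear)
  finally have P: "ip I (lap I p) p \<ge> 4 * (?n - 1) * ip I p p" by (simp add: algebra_simps)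
  have Q: "ip I (lap I q) q \<ge> 4 * (?n - 1) * ip I q q"
    using gap[OF q2] inner_on_nonneg[of "perms I" q] by (simp add: algebra_simps)
  have "lap I f = (\<lambda>x. lap I p x + lap I q x)"
    by (subst f_eq) (simp add: lap_def fun_eq_iff sum.distrib sum_subtractf algebra_simps)
  then have "ip I (lap I f) f = ip I (lap I p) p + ip I (lap I q) q"
    by (simp add: f_eq inner_on_linear lpq lqp)
  moreover have "ip I f f = ip I p p + ip I q q"
    by (simp add: f_eq inner_on_linear pq)
  ultimately show ?thesis using P Q by (simp add: algebra_simps)
qed

section \<open>Spectral gaps by induction through point stabilisers\<close>

lemma sum_perms_coset:
  assumes "finite I" "a \<in> I"
  shows "(\<Sum>p\<in>perms I. F p)
    = (\<Sum>c\<in>I. \<Sum>q\<in>perms (I - {a}). F (Transposition.transpose a c \<circ> q))"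
  using sum_over_permutations_insert[of "I - {a}" a F] assms by (simp add: insert_absorb)

text \<open>For \<open>q\<close> fixing \<open>a\<close>, the permutation
  \<open>transpose a c \<circ> q\<close> sends \<open>a\<close> to \<open>c\<close>, and it sends
  \<open>b\<close> to \<open>transpose a c d\<close> exactly when \<open>q b = d\<close>. So
  \<open>fix1 b d\<close> on the smaller group is a \<open>fix2\<close> indicator on the larger
  one.\<close>

lemma perp1_coset:
  assumes I: "finite I" and f: "perp2 I f" and a: "a \<in> I" and c: "c \<in> I"
  shows "perp1 (I - {a}) (\<lambda>q. f (Transposition.transpose a c \<circ> q))"
  unfolding perp1_def
proof (intro ballI)
  fix b d assume b: "b \<in> I - {a}" and d: "d \<in> I - {a}"
  let ?d = "Transposition.transpose a c d"
  have "?d \<in> I" using a c d by (auto simp: Transposition.transpose_def)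
  then have "0 = ip I f (fix2 a b c ?d)" using perp2D[OF f] a b c by simp
  also have "\<dots> = (\<Sum>c'\<in>I. \<Sum>q\<in>perms (I - {a}). f (Transposition.transpose a c' \<circ> q)
      * fix2 a b c ?d (Transposition.transpose a c' \<circ> q))"
    unfolding inner_on_def by (rule sum_perms_coset[OF I a])
  also have "\<dots> = (\<Sum>c'\<in>I. if c' = c then
      (\<Sum>q\<in>perms (I - {a}). f (Transposition.transpose a c \<circ> q) * fix1 b d q) else 0)"
  proof (intro sum.cong refl)
    fix c' assume "c' \<in> I"
    have qa: "q a = a" if "q permutes I - {a}" for q
      using that by (auto intro: permutes_not_in)
    have "fix2 a b c ?d (Transposition.transpose a c' \<circ> q) = (if c' = c then fix1 b d q else 0)"
      if "q permutes I - {a}" for q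
      using qa[OF that] by (auto simp: fix2_def fix1_def inj_eq[OF inj_transpose])
    then show "(\<Sum>q\<in>perms (I - {a}). f (Transposition.transpose a c' \<circ> q)
        * fix2 a b c ?d (Transposition.transpose a c' \<circ> q)) = (if c' = c then
      (\<Sum>q\<in>perms (I - {a}). f (Transposition.transpose a c \<circ> q) * fix1 b d q) else 0)"
      by simp
  qed
  also have "\<dots> = ip (I - {a}) (\<lambda>q. f (Transposition.transpose a c \<circ> q)) (fix1 b d)"
    using I c by (simp add: inner_on_def)
  finally show "ip (I - {a}) (\<lambda>q. f (Transposition.transpose a c \<circ> q)) (fix1 b d) = 0" ..
qed

text \<open>A pair of distinct points survives the deletion of each of the other
  \<open>card I - 2\<close> points; diagonal terms are zero.\<close>

lemma sum_delete_point:
  fixes Y :: "'a \<Rightarrow> 'a \<Rightarrow> real"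
  assumes I: "finite I" and Y: "\<And>i. Y i i = 0"
  shows "(\<Sum>a\<in>I. \<Sum>i\<in>I - {a}. \<Sum>j\<in>I - {a}. Y i j)
    = (real (card I) - 2) * (\<Sum>i\<in>I. \<Sum>j\<in>I. Y i j)"
proof -
  have "(\<Sum>a\<in>I. \<Sum>i\<in>I - {a}. \<Sum>j\<in>I - {a}. Y i j)
      = (\<Sum>a\<in>I. \<Sum>i\<in>I. \<Sum>j\<in>I. of_bool (a \<noteq> i \<and> a \<noteq> j) * Y i j)"
  proof (rule sum.cong[OF refl])
    fix a
    have "(\<Sum>j\<in>I - {a}. Y i j) = (\<Sum>j\<in>I. of_bool (a \<noteq> j) * Y i j)" for i
      using I by (intro sum.mono_neutral_cong_left) auto
    then have "(\<Sum>i\<in>I - {a}. \<Sum>j\<in>I - {a}. Y i j) = (\<Sum>i\<in>I - {a}. \<Sum>j\<in>I. of_bool (a \<noteq> j) * Y i j)"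
      by simp
    also have "\<dots> = (\<Sum>i\<in>I. \<Sum>j\<in>I. of_bool (a \<noteq> i \<and> a \<noteq> j) * Y i j)"
      using I by (intro sum.mono_neutral_cong_left) auto
    finally show "(\<Sum>i\<in>I - {a}. \<Sum>j\<in>I - {a}. Y i j)
      = (\<Sum>i\<in>I. \<Sum>j\<in>I. of_bool (a \<noteq> i \<and> a \<noteq> j) * Y i j)" .
  qed
  also have "\<dots> = (\<Sum>i\<in>I. \<Sum>a\<in>I. \<Sum>j\<in>I. of_bool (a \<noteq> i \<and> a \<noteq> j) * Y i j)"
    by (rule sum.swap)
  also have "\<dots> = (\<Sum>i\<in>I. \<Sum>j\<in>I. \<Sum>a\<in>I. of_bool (a \<noteq> i \<and> a \<noteq> j) * Y i j)"
    by (intro sum.cong refl sum.swap)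
  also have "\<dots> = (\<Sum>i\<in>I. \<Sum>j\<in>I. (real (card I) - 2) * Y i j)"
  proof (intro sum.cong refl)
    fix i j assume ij: "i \<in> I" "j \<in> I"
    show "(\<Sum>a\<in>I. of_bool (a \<noteq> i \<and> a \<noteq> j) * Y i j) = (real (card I) - 2) * Y i j"
    proof (cases "i = j")
      case False
      have "(\<Sum>a\<in>I. of_bool (a \<noteq> i \<and> a \<noteq> j) * Y i j) = (\<Sum>a\<in>I - {i, j}. Y i j)"
        using I by (intro sum.mono_neutral_cong_right) auto
      moreover have "card (I - {i, j}) = card I - 2" "card {i, j} \<le> card I"
        using I ij False card_mono[of I "{i, j}"] by (auto simp: card_Diff_subset)
      ultimately show ?thesis using False by (simp add: of_nat_diff)
    qed (simp add: Y)
  qed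
  finally show ?thesis by (simp add: sum_distrib_left)
qed

text \<open>Deleting each point \<open>a\<close> in turn and restricting \<open>f\<close> to the cosets of the stabiliser of \<open>a\<close>
  uses every transposition equally often.\<close>
lemma perp2_gap_if_perp1_gap:
  assumes I: "finite I" "card I \<ge> 3" and f: "perp2 I f"
    and gap: "\<And>a h. a \<in> I \<Longrightarrow> perp1 (I - {a}) h \<Longrightarrow>
      ip (I - {a}) (lap (I - {a}) h) h \<ge> 4 * (real (card I) - 2) * ip (I - {a}) h h"
  shows "ip I (lap I f) f \<ge> 4 * real (card I) * ip I f f"
proof -
  let ?n = "real (card I)"
  define Y where "Y i j = (\<Sum>p\<in>perms I. (f p - f (p \<circ> Transposition.transpose i j))\<^sup>2)" for i j
  have le: "(\<Sum>i\<in>I - {a}. \<Sum>j\<in>I - {a}. Y i j) \<ge> 8 * (?n - 2) * ip I f f" if a: "a \<in> I" for a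
  proof -
    let ?J = "I - {a}"
    define fc where "fc c = (\<lambda>q. f (Transposition.transpose a c \<circ> q))" for c
    have "8 * (?n - 2) * ip I f f = (\<Sum>c\<in>I. 2 * (4 * (?n - 2) * ip ?J (fc c) (fc c)))"
      unfolding inner_on_def sum_perms_coset[OF I(1) a] fc_def by (simp add: sum_distrib_left algebra_simps)
    also have "\<dots> \<le> (\<Sum>c\<in>I. 2 * ip ?J (lap ?J (fc c)) (fc c))"
    proof (rule sum_mono)
      fix c assume "c \<in> I"
      then have "perp1 ?J (fc c)" unfolding fc_def by (rule perp1_coset[OF I(1) f a])
      from gap[OF a this]
      show "2 * (4 * (?n - 2) * ip ?J (fc c) (fc c)) \<le> 2 * ip ?J (lap ?J (fc c)) (fc c)" by simp
    qed
    also have "\<dots> = (\<Sum>c\<in>I. \<Sum>i\<in>?J. \<Sum>j\<in>?J. \<Sum>q\<in>perms ?J.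
        (f (Transposition.transpose a c \<circ> q)
         - f (Transposition.transpose a c \<circ> q \<circ> Transposition.transpose i j))\<^sup>2)"
      unfolding lap_quadratic_form by (simp add: fc_def o_assoc)
    also have "\<dots> = (\<Sum>i\<in>?J. \<Sum>c\<in>I. \<Sum>j\<in>?J. \<Sum>q\<in>perms ?J.
        (f (Transposition.transpose a c \<circ> q)
         - f (Transposition.transpose a c \<circ> q \<circ> Transposition.transpose i j))\<^sup>2)"
      by (rule sum.swap)
    also have "\<dots> = (\<Sum>i\<in>?J. \<Sum>j\<in>?J. \<Sum>c\<in>I. \<Sum>q\<in>perms ?J.
        (f (Transposition.transpose a c \<circ> q)
         - f (Transposition.transpose a c \<circ> q \<circ> Transposition.transpose i j))\<^sup>2)"
      by (intro sum.cong refl sum.swap)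
    also have "\<dots> = (\<Sum>i\<in>?J. \<Sum>j\<in>?J. Y i j)"
      unfolding Y_def sum_perms_coset[OF I(1) a] ..
    finally show ?thesis .
  qed
  \<comment> \<open>Summing over the deleted point gains a factor \<open>n\<close>, while each
    transposition is counted \<open>n - 2\<close> times. This turns the gap \<open>4 (n - 2)\<close>
    into \<open>4 n\<close>.\<close>
  have "?n * (8 * (?n - 2) * ip I f f) = (\<Sum>a\<in>I. 8 * (?n - 2) * ip I f f)" by simp
  also have "\<dots> \<le> (\<Sum>a\<in>I. \<Sum>i\<in>I - {a}. \<Sum>j\<in>I - {a}. Y i j)"
    by (rule sum_mono) (rule le)
  also have "\<dots> = (?n - 2) * (\<Sum>i\<in>I. \<Sum>j\<in>I. Y i j)"
    by (rule sum_delete_point[OF I(1)]) (simp add: Y_def)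
  also have "\<dots> = (?n - 2) * (2 * ip I (lap I f) f)"
    unfolding lap_quadratic_form Y_def ..
  finally have "(?n - 2) * (8 * ?n * ip I f f) \<le> (?n - 2) * (2 * ip I (lap I f) f)"
    by (simp add: algebra_simps)
  then show ?thesis using I(2) by (subst (asm) mult_le_cancel_left_pos) auto
qed

text \<open>On two points the \<open>fix1\<close> indicators separate the two permutations, so
  \<open>f\<close> vanishes on the group; on fewer points the claimed bound is not positive.\<close>

lemma perp1_gap_small:
  assumes I: "finite I" "card I \<le> 2" and f: "perp1 I f"
  shows "ip I (lap I f) f \<ge> 4 * (real (card I) - 1) * ip I f f"
proof (cases "card I = 2")
  case True
  then obtain a b where ab: "I = {a, b}" "a \<noteq> b" by (auto simp: card_2_iff)
  have S: "perms I = {id, Transposition.transpose a b}"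
    unfolding ab(1) by (auto simp: permutes_doubleton_iff)
  have ne: "id \<noteq> Transposition.transpose a b"
    using ab(2) by (auto simp: fun_eq_iff Transposition.transpose_def)
  have "f id = 0" using perp1D[OF f, of a a] ab ne unfolding S inner_on_def by (simp add: fix1_def)
  moreover have "f (Transposition.transpose a b) = 0"
    using perp1D[OF f, of a b] ab ne unfolding S inner_on_def by (simp add: fix1_def)
  ultimately have "ip I f f = 0" unfolding S inner_on_def using ne by simp
  then show ?thesis using lap_nonneg[of I f] by simp
next
  case False
  then have "real (card I) - 1 \<le> 0" using I by simp
  then have "4 * (real (card I) - 1) * ip I f f \<le> 0"
    using inner_on_nonneg[of "perms I" f] by (simp add: mult_nonpos_nonneg)
  then show ?thesis using lap_nonneg[of I f] by linarith
qed

text \<open>The induction alternates: the \<open>perp1\<close> gap on \<open>I - {a}\<close> gives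
  the \<open>perp2\<close> gap on \<open>I\<close>, which gives the \<open>perp1\<close> gap on
  \<open>I\<close>.\<close>

lemma perp1_gap:
  assumes "finite I" "perp1 I f"
  shows "ip I (lap I f) f \<ge> 4 * (real (card I) - 1) * ip I f f"
  using assms
proof (induction "card I" arbitrary: I f rule: less_induct)
  case less
  show ?case
  proof (cases "card I \<le> 2")
    case True
    then show ?thesis using less.prems by (intro perp1_gap_small)
  next
    case False
    show ?thesis
    proof (rule perp1_gap_if_perp2_gap[OF less.prems])
      fix q assume q: "perp2 I q"
      show "ip I (lap I q) q \<ge> 4 * real (card I) * ip I q q"
      proof (rule perp2_gap_if_perp1_gap[OF less.prems(1) _ q])
        fix a h assume a: "a \<in> I" and h: "perp1 (I - {a}) h"
        have "card (I - {a}) < card I" "real (card (I - {a})) - 1 = real (card I) - 2"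
          using a False less.prems(1) by (auto simp: card_Diff_singleton of_nat_diff)
        with less.hyps[of "I - {a}" h] h less.prems(1)
        show "ip (I - {a}) (lap (I - {a}) h) h \<ge> 4 * (real (card I) - 2) * ip (I - {a}) h h" by simp
      qed (use False in simp)
    qed
  qed
qed

lemma perp2_gap:
  assumes I: "finite I" "card I \<ge> 3" and f: "perp2 I f"
  shows "ip I (lap I f) f \<ge> 4 * real (card I) * ip I f f"
proof (rule perp2_gap_if_perp1_gap[OF I f])
  fix a h assume a: "a \<in> I" and h: "perp1 (I - {a}) h"
  have "real (card (I - {a})) - 1 = real (card I) - 2"
    using a I by (simp add: card_Diff_singleton of_nat_diff)
  moreover have "ip (I - {a}) (lap (I - {a}) h) h \<ge> 4 * (real (card (I - {a})) - 1) * ip (I - {a}) h h"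
    using perp1_gap[OF _ h] I by simp
  ultimately show "ip (I - {a}) (lap (I - {a}) h) h \<ge> 4 * (real (card I) - 2) * ip (I - {a}) h h"
    by (simp only:)
qed

section \<open>The eigenvalue \<open>4n - 4\<close> of the Laplacian\<close>

text \<open>The eigenvalue is read off by pairing the eigenvector with the constant function, with the
  indicators \<open>fix1\<close>, or with the indicators \<open>fix2\<close>, whichever pairing is the first not to vanish.\<close>
lemma lap_eigenvalue_cases:
  assumes I: "finite I" "card I \<ge> 3"
    and eig: "\<And>p. p permutes I \<Longrightarrow> lap I f p = \<mu> * f p"
    and nz: "\<exists>p. p permutes I \<and> f p \<noteq> 0" and \<mu>: "\<mu> < 4 * real (card I)"
  shows "\<mu> = 0 \<or> \<mu> = 2 * real (card I) \<or> \<mu> = 4 * real (card I) - 4"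
proof -
  let ?n = "real (card I)"
  have ip_eig: "ip I (lap I f) g = \<mu> * ip I f g" for g
  proof -
    have "ip I (lap I f) g = ip I (\<lambda>p. \<mu> * f p) g" by (intro inner_on_cong_left) (simp add: eig)
    then show ?thesis by (simp add: inner_on_linear)
  qed
  have "finite (perms I)" using I by (simp add: finite_permutations)
  then have pos: "ip I f f > 0"
    using nz inner_on_eq_0_iff[of "perms I" f] inner_on_nonneg[of "perms I" f] by fastforce
  show ?thesis
  proof (cases "ip I f (\<lambda>_. 1) = 0")
    case False
    then show ?thesis using ip_eig[of "\<lambda>_. 1"] ip_lap_one[of I f] by simp
  next
    case one: True
    show ?thesis
    proof (cases "perp1 I f")
      case False
      then obtain a c where ac: "a \<in> I" "c \<in> I" "ip I f (fix1 a c) \<noteq> 0" by (auto simp: perp1_def)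
      then have "\<mu> * ip I f (fix1 a c) = (2 * ?n) * ip I f (fix1 a c)"
        using ip_lap_fix1[OF I(1) ac(1,2), of f] one ip_eig[of "fix1 a c"] by simp
      then show ?thesis using ac by simp
    next
      case p1: True
      have "\<not> perp2 I f"
      proof
        assume "perp2 I f"
        from perp2_gap[OF I this] have "4 * ?n * ip I f f \<le> \<mu> * ip I f f" by (simp add: ip_eig)
        then show False using pos \<mu> by (simp add: mult_le_cancel_right)
      qed
      then obtain a b c d where abcd: "a \<in> I" "b \<in> I" "c \<in> I" "d \<in> I" "a \<noteq> b" "c \<noteq> d"
        and y: "ip I f (fix2 a b c d) \<noteq> 0"
        using perp2I[OF p1] by blast
      \<comment> \<open>In terms of \<open>x\<close> the two \<open>fix2\<close> relations read
        \<open>x * s = - t\<close> and \<open>x * t = - s\<close>, so \<open>x\<close> is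
        \<open>1\<close> or \<open>- 1\<close>. These mean \<open>\<mu> = 4 n\<close>, which is
        excluded, and \<open>\<mu> = 4 n - 4\<close>.\<close>
      define x where "x = \<mu> / 2 - (2 * ?n - 1)"
      define s t where "s = ip I f (fix2 a b c d)" and "t = ip I f (fix2 b a c d)"
      have "x * s = - t" "x * t = - s"
        using ip_lap_fix2[OF I(1) abcd, of f] ip_lap_fix2[OF I(1) abcd(2,1,3,4) _ abcd(6), of f]
          ip_eig[of "fix2 a b c d"] ip_eig[of "fix2 b a c d"] perp1D[OF p1] abcd
        by (simp_all add: x_def s_def t_def algebra_simps)
      then have "x * x * s = s" by (metis mult.assoc mult_minus_right minus_minus)
      then have "x * x = 1" using y by (simp add: s_def)
      then have "x = 1 \<or> x = - 1" by (simp add: square_eq_1_iff)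
      then show ?thesis using \<mu> by (auto simp: x_def field_simps)
    qed
  qed
qed

section \<open>The matrix space S and the tensor of an eigenfunction\<close>

definition sym0 :: "'a set \<Rightarrow> ('a \<Rightarrow> 'a \<Rightarrow> real) \<Rightarrow> bool" where
  "sym0 I w \<longleftrightarrow> (\<forall>a\<in>I. \<forall>b\<in>I. w a b = w b a) \<and> (\<forall>a\<in>I. w a a = 0) \<and> (\<forall>a\<in>I. (\<Sum>b\<in>I. w a b) = 0)"

lemma sym0D:
  assumes "sym0 I w"
  shows "a \<in> I \<Longrightarrow> b \<in> I \<Longrightarrow> w a b = w b a" "a \<in> I \<Longrightarrow> w a a = 0"
    "a \<in> I \<Longrightarrow> (\<Sum>b\<in>I. w a b) = 0" "b \<in> I \<Longrightarrow> (\<Sum>a\<in>I. w a b) = 0"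
proof -
  show sym: "a \<in> I \<Longrightarrow> b \<in> I \<Longrightarrow> w a b = w b a" for a b
    using assms unfolding sym0_def by blast
  show "a \<in> I \<Longrightarrow> w a a = 0" and row: "a \<in> I \<Longrightarrow> (\<Sum>b\<in>I. w a b) = 0" for a
    using assms unfolding sym0_def by blast+
  have "(\<Sum>a\<in>I. w a b) = (\<Sum>a\<in>I. w b a)" if "b \<in> I"
    using sym that by (intro sum.cong) auto
  then show "b \<in> I \<Longrightarrow> (\<Sum>a\<in>I. w a b) = 0" using row by simp
qed

context
  fixes I :: "'a set" and f :: "('a \<Rightarrow> 'a) \<Rightarrow> real"
  assumes I: "finite I" "card I \<ge> 3"
    and eig: "\<And>p. p permutes I \<Longrightarrow> lap I f p = (4 * real (card I) - 4) * f p"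
begin

lemma ip_lap_eig: "ip I (lap I f) g = (4 * real (card I) - 4) * ip I f g"
proof -
  have "ip I (lap I f) g = ip I (\<lambda>p. (4 * real (card I) - 4) * f p) g"
    by (intro inner_on_cong_left) (simp add: eig)
  then show ?thesis by (simp add: inner_on_linear)
qed

text \<open>For \<open>card I \<ge> 3\<close> the eigenvalue differs from \<open>0\<close> and from
  \<open>2 n\<close>, which forces the pairings with the constant and then with \<open>fix1\<close>
  to vanish.\<close>

lemma eigenfunction_perp1: "perp1 I f"
  unfolding perp1_def
proof (intro ballI)
  fix a c assume ac: "a \<in> I" "c \<in> I"
  have "(4 * real (card I) - 4) * ip I f (\<lambda>_. 1) = 0"
    using ip_lap_eig[of "\<lambda>_. 1"] ip_lap_one[of I f] by simp
  then have "ip I f (\<lambda>_. 1) = 0" using I by auto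
  then have "(2 * real (card I) - 4) * ip I f (fix1 a c) = 0"
    using ip_lap_eig[of "fix1 a c"] ip_lap_fix1[OF I(1) ac, of f] by (simp add: algebra_simps)
  then show "ip I f (fix1 a c) = 0" using I by auto
qed

text \<open>Once the \<open>fix1\<close> terms are gone, the \<open>fix2\<close> relation at
  \<open>4 n - 4\<close> reads \<open>(2 n - 2) s = (2 n - 1) s - t\<close> for the two pairings
  \<open>s\<close> and \<open>t\<close>.\<close>

lemma eigenfunction_fix2_swap:
  assumes "a \<in> I" "b \<in> I" "c \<in> I" "d \<in> I" "c \<noteq> d"
  shows "ip I f (fix2 a b c d) = ip I f (fix2 b a c d)"
proof (cases "a = b")
  case False
  show ?thesis
    using ip_lap_eig[of "fix2 a b c d"] ip_lap_fix2[OF I(1) assms(1-4) False assms(5), of f]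
      perp1D[OF eigenfunction_perp1] assms by (simp add: algebra_simps)
qed simp

lemma eigenfunction_sym0_source:
  assumes "c \<in> I" "d \<in> I" "c \<noteq> d"
  shows "sym0 I (\<lambda>a b. ip I f (fix2 a b c d))"
  unfolding sym0_def
proof (intro conjI ballI)
  fix a assume a: "a \<in> I"
  have "(\<Sum>b\<in>I. ip I f (fix2 a b c d)) = ip I f (fix1 a c)"
    unfolding inner_on_sum_right[symmetric]
    using I assms by (intro inner_on_cong_right) (simp add: sum_fix2_second)
  then show "(\<Sum>b\<in>I. ip I f (fix2 a b c d)) = 0"
    using perp1D[OF eigenfunction_perp1] a assms by simp
qed (use assms eigenfunction_fix2_swap in \<open>auto simp: ip_fix2_eq_0\<close>)

text \<open>Exchanging the points and the values simultaneously leaves \<open>fix2\<close>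
  unchanged, so symmetry in the points passes to the values. Row sums are again pairings with
  \<open>fix1\<close>.\<close>

lemma eigenfunction_sym0_target:
  assumes "a \<in> I" "b \<in> I" "a \<noteq> b"
  shows "sym0 I (\<lambda>c d. ip I f (fix2 a b c d))"
  unfolding sym0_def
proof (intro conjI ballI)
  fix c d assume "c \<in> I" "d \<in> I"
  then show "ip I f (fix2 a b c d) = ip I f (fix2 a b d c)"
    using eigenfunction_fix2_swap[of a b c d] assms by (cases "c = d") (auto simp: fix2_swap[of a b d c])
next
  fix c assume c: "c \<in> I"
  have "(\<Sum>d\<in>I. fix2 a b c d p) = fix1 a c p" if "p permutes I" for p
  proof -
    have "(\<Sum>d\<in>I. fix2 a b c d p) = fix1 a c p * (\<Sum>d\<in>I. fix1 b d p)"
      unfolding sum_distrib_left by (simp add: fix1_def fix2_def of_bool_conj)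
    then show ?thesis using sum_fix1_target[OF I(1) assms(2) that] by simp
  qed
  then have "(\<Sum>d\<in>I. ip I f (fix2 a b c d)) = ip I f (fix1 a c)"
    unfolding inner_on_sum_right[symmetric] by (intro inner_on_cong_right) simp
  then show "(\<Sum>d\<in>I. ip I f (fix2 a b c d)) = 0"
    using perp1D[OF eigenfunction_perp1] c assms by simp
qed (use assms in \<open>auto simp: ip_fix2_eq_0\<close>)

text \<open>Such an \<open>f\<close> satisfies \<open>perp2\<close>, where the gap
  \<open>4 n\<close> exceeds the eigenvalue \<open>4 n - 4\<close>.\<close>

lemma eigenfunction_eq_0:
  assumes "\<And>a b c d. a \<in> I \<Longrightarrow> b \<in> I \<Longrightarrow> c \<in> I \<Longrightarrow> d \<in> I \<Longrightarrow> a \<noteq> b \<Longrightarrow> c \<noteq> d \<Longrightarrow> ip I f (fix2 a b c d) = 0"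
    and "p permutes I"
  shows "f p = 0"
proof -
  have "perp2 I f" using assms(1) by (rule perp2I[OF eigenfunction_perp1])
  from perp2_gap[OF I this] have "ip I f f \<le> 0" by (simp add: ip_lap_eig algebra_simps)
  then have "ip I f f = 0" using inner_on_nonneg[of "perms I" f] by simp
  then show ?thesis using assms(2) I by (simp add: inner_on_eq_0_iff finite_permutations)
qed

end

section \<open>Eigenfunctions from pairs of matrices in S, and a basis of S\<close>

definition pairing :: "'a set \<Rightarrow> ('a \<Rightarrow> 'a \<Rightarrow> real) \<Rightarrow> ('a \<Rightarrow> 'a \<Rightarrow> real) \<Rightarrow> ('a \<Rightarrow> 'a) \<Rightarrow> real" where
  "pairing I w z p = (\<Sum>a\<in>I. \<Sum>b\<in>I. w a b * z (p a) (p b))"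

text \<open>In \<open>sum_transpose_pair\<close> the row sums and diagonal entries drop out, and
  symmetry merges the two remaining terms into \<open>2 ((2 n - 1) - 1)\<close>.\<close>

lemma sum_transpose_sym0:
  assumes I: "finite I" and w: "sym0 I w" and ab: "a \<in> I" "b \<in> I"
  shows "(\<Sum>i\<in>I. \<Sum>j\<in>I. w a b - w (Transposition.transpose i j a) (Transposition.transpose i j b))
    = (4 * real (card I) - 4) * w a b"
proof (cases "a = b")
  case True
  have "Transposition.transpose i j b \<in> I" if "i \<in> I" "j \<in> I" for i j
    using that ab by (auto simp: Transposition.transpose_def)
  then show ?thesis using True ab sym0D(2)[OF w] by simp
next
  case False
  show ?thesis
    using sum_transpose_pair[OF I ab False, of w] sym0D(1)[OF w ab(2) ab(1)] sym0D(2,3)[OF w ab(1)]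
      sym0D(2,4)[OF w ab(2)] by (simp add: algebra_simps)
qed

text \<open>Reindexing both sums by the transposition moves it from the permutation to the weights,
  so \<open>lap\<close> acts on \<open>w\<close> alone.\<close>

lemma pairing_transpose:
  assumes "i \<in> I" "j \<in> I"
  shows "pairing I w z (p \<circ> Transposition.transpose i j)
    = (\<Sum>a\<in>I. \<Sum>b\<in>I. w (Transposition.transpose i j a) (Transposition.transpose i j b) * z (p a) (p b))"
proof -
  let ?t = "Transposition.transpose i j"
  have t: "?t permutes I" using assms by (rule permutes_swap_id)
  have "(\<Sum>a\<in>I. \<Sum>b\<in>I. w (?t a) (?t b) * z (p a) (p b))
      = (\<Sum>a\<in>I. \<Sum>b\<in>I. w (?t (?t a)) (?t b) * z (p (?t a)) (p b))"
    using sum.permute[OF t, of "\<lambda>a. \<Sum>b\<in>I. w (?t a) (?t b) * z (p a) (p b)"] by simp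
  also have "\<dots> = (\<Sum>a\<in>I. \<Sum>b\<in>I. w (?t (?t a)) (?t (?t b)) * z (p (?t a)) (p (?t b)))"
    using sum.permute[OF t, of "\<lambda>b. w (?t (?t a)) (?t b) * z (p (?t a)) (p b)" for a] by simp
  finally show ?thesis by (simp add: pairing_def)
qed

lemma lap_pairing:
  assumes I: "finite I" and w: "sym0 I w"
  shows "lap I (pairing I w z) p = (4 * real (card I) - 4) * pairing I w z p"
proof -
  let ?D = "\<lambda>i j a b. w a b - w (Transposition.transpose i j a) (Transposition.transpose i j b)"
  have "lap I (pairing I w z) p
      = (\<Sum>i\<in>I. \<Sum>j\<in>I. \<Sum>a\<in>I. \<Sum>b\<in>I. ?D i j a b * z (p a) (p b))"
    unfolding lap_def
    by (intro sum.cong refl, subst pairing_transpose) (auto simp: pairing_def sum_subtractf algebra_simps)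
  also have "\<dots> = (\<Sum>a\<in>I. \<Sum>b\<in>I. \<Sum>i\<in>I. \<Sum>j\<in>I. ?D i j a b * z (p a) (p b))"
    unfolding sum.cartesian_product
    by (rule sum.reindex_bij_witness[where i = "\<lambda>(a, b, i, j). (i, j, a, b)"
          and j = "\<lambda>(i, j, a, b). (a, b, i, j)"]) auto
  also have "\<dots> = (\<Sum>a\<in>I. \<Sum>b\<in>I. ((4 * real (card I) - 4) * w a b) * z (p a) (p b))"
  proof (intro sum.cong refl)
    fix a b assume ab: "a \<in> I" "b \<in> I"
    show "(\<Sum>i\<in>I. \<Sum>j\<in>I. ?D i j a b * z (p a) (p b)) = ((4 * real (card I) - 4) * w a b) * z (p a) (p b)"
      unfolding sum_transpose_sym0[OF I w ab, symmetric] by (simp add: sum_distrib_right)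
  qed
  also have "\<dots> = (4 * real (card I) - 4) * pairing I w z p"
    by (simp add: pairing_def sum_distrib_left mult.assoc)
  finally show ?thesis .
qed

text \<open>An invariant matrix takes only three values off the diagonal, and the vanishing row sums
  express all of them through \<open>Z a b\<close>.\<close>
lemma sum_sym0_stabiliser_invariant:
  assumes I: "finite I" "card I \<ge> 4" and ab: "a \<in> I" "b \<in> I" "a \<noteq> b"
    and w: "sym0 I w" and Z: "sym0 I Z"
    and inv: "\<And>k l x y. k \<in> I - {a, b} \<Longrightarrow> l \<in> I - {a, b} \<Longrightarrow> x \<in> I \<Longrightarrow> y \<in> I \<Longrightarrow>
      Z (Transposition.transpose k l x) (Transposition.transpose k l y) = Z x y"
  defines "n \<equiv> real (card I)"
  shows "(\<Sum>x\<in>I. \<Sum>y\<in>I. w x y * Z x y)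
    = 2 * (1 + 2 / (n - 2) + 2 / ((n - 2) * (n - 3))) * Z a b * w a b"
proof -
  define K where "K = I - {a, b}"
  have IK: "I = insert a (insert b K)" "a \<notin> K" "b \<notin> K" "finite K" using I ab by (auto simp: K_def)
  have cK: "real (card K) = n - 2"
    unfolding n_def by (subst IK(1)) (use IK(2-) ab in simp)
  have n: "n \<ge> 4" using I(2) by (simp add: n_def)
  have other: "Transposition.transpose k l x = x" if "x \<noteq> k" "x \<noteq> l" for k l x :: 'a
    using that by (metis transpose_apply_other)
  define \<zeta> where "\<zeta> = Z a b"
  \<comment> \<open>\<open>\<alpha>\<close> is the common entry between \<open>{a, b}\<close> and
    \<open>K\<close>, and \<open>\<beta>\<close> the one within \<open>K\<close>. Row
    \<open>a\<close> reads \<open>\<zeta> + (n - 2) * \<alpha> = 0\<close>, and the row of a point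
    of \<open>K\<close> reads \<open>2 * \<alpha> + (n - 3) * \<beta> = 0\<close>.\<close>
  define \<alpha> where "\<alpha> = - \<zeta> / (n - 2)"
  define \<beta> where "\<beta> = - 2 * \<alpha> / (n - 3)"
  define u where "u x = (of_bool (x = a \<or> x = b) :: real)" for x
  have one_point: "Z x k = \<alpha>" if x: "x = a \<or> x = b" and k: "k \<in> K" for x k
  proof -
    have xI: "x \<in> I" "x \<notin> K" using x ab IK by auto
    have "Z x l = Z x k" if l: "l \<in> K" for l
      using inv[of k l x k] other[of x k l] xI k l by (auto simp: K_def)
    then have "(\<Sum>l\<in>K. Z x l) = (n - 2) * Z x k" by (simp add: cK)
    moreover have "(\<Sum>y\<in>I. Z x y) = Z x a + (Z x b + (\<Sum>l\<in>K. Z x l))"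
      by (subst IK(1)) (use IK(2-) ab in simp)
    moreover have "Z x a + Z x b = \<zeta>"
      using x sym0D(1)[OF Z ab(1,2)] sym0D(2)[OF Z] ab by (auto simp: \<zeta>_def)
    ultimately have "(n - 2) * Z x k = - \<zeta>" using sym0D(3)[OF Z xI(1)] by linarith
    then show ?thesis using n by (simp add: \<alpha>_def field_simps)
  qed
  have two_points: "Z k l = \<beta>" if k: "k \<in> K" and l: "l \<in> K" "l \<noteq> k" for k l
  proof -
    have kI: "k \<in> I" using k by (simp add: K_def)
    have "Z k m = Z k l" if m: "m \<in> K - {k}" for m
      using inv[of l m k l] other[of k l m] k l m by (auto simp: K_def)
    then have "(\<Sum>m\<in>K - {k}. Z k m) = real (card (K - {k})) * Z k l" by simp
    also have "real (card (K - {k})) = n - 3"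
      using k cK IK(4) n by (simp add: card_Diff_singleton of_nat_diff card_gt_0_iff)
    finally have "(\<Sum>m\<in>K - {k}. Z k m) = (n - 3) * Z k l" .
    moreover have "(\<Sum>y\<in>I. Z k y) = Z k a + (Z k b + (\<Sum>l\<in>K. Z k l))"
      by (subst IK(1)) (use IK(2-) ab in simp)
    moreover have "(\<Sum>m\<in>K. Z k m) = Z k k + (\<Sum>m\<in>K - {k}. Z k m)"
      using k IK(4) by (rule sum.remove[rotated])
    moreover have "Z k a = \<alpha>" "Z k b = \<alpha>"
      using one_point[of a k] one_point[of b k] k sym0D(1)[OF Z kI] ab by auto
    ultimately have "(n - 3) * Z k l = - 2 * \<alpha>"
      using sym0D(2,3)[OF Z kI] by linarith
    then show ?thesis using n by (simp add: \<beta>_def field_simps)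
  qed
  \<comment> \<open>Interpolation in the indicator \<open>u\<close> of \<open>{a, b}\<close>: the
    value is \<open>\<beta>\<close>, \<open>\<alpha>\<close> or \<open>\<zeta>\<close> when none,
    one or both indices lie there. Summed against \<open>w\<close>, whose row and column sums
    vanish, only the term with \<open>u x * u y\<close> survives.\<close>
  have Z_eq: "Z x y = \<beta> + (\<alpha> - \<beta>) * (u x + u y) + (\<zeta> - 2 * \<alpha> + \<beta>) * (u x * u y)"
    if xy: "x \<in> I" "y \<in> I" "x \<noteq> y" for x y
  proof -
    have "x \<in> insert a (insert b K)" "y \<in> insert a (insert b K)"
      using xy(1,2) by (simp_all flip: IK(1))
    then consider "x = a" "y = b" | "x = b" "y = a" | "x = a \<or> x = b" "y \<in> K"
      | "y = a \<or> y = b" "x \<in> K" | "x \<in> K" "y \<in> K"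
      using xy(3) by blast
    then show ?thesis
    proof cases
      case 3
      then have "u x = 1" "u y = 0" using IK by (auto simp: u_def)
      then show ?thesis using one_point[OF 3] by simp
    next
      case 4
      then have "u y = 1" "u x = 0" using IK by (auto simp: u_def)
      then show ?thesis using one_point[OF 4] sym0D(1)[OF Z xy(1,2)] by simp
    next
      case 5
      then have "u y = 0" "u x = 0" using IK by (auto simp: u_def)
      then show ?thesis using two_points 5 xy by simp
    qed (use sym0D(1)[OF Z ab(1,2)] in \<open>simp_all add: u_def \<zeta>_def\<close>)
  qed
  have "(\<Sum>x\<in>I. \<Sum>y\<in>I. w x y * Z x y) = (\<Sum>x\<in>I. \<Sum>y\<in>I. \<beta> * w x y
      + (\<alpha> - \<beta>) * (u x * w x y + u y * w x y) + (\<zeta> - 2 * \<alpha> + \<beta>) * (u x * (u y * w x y)))"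
  proof (intro sum.cong refl)
    fix x y assume xy: "x \<in> I" "y \<in> I"
    show "w x y * Z x y = \<beta> * w x y
      + (\<alpha> - \<beta>) * (u x * w x y + u y * w x y) + (\<zeta> - 2 * \<alpha> + \<beta>) * (u x * (u y * w x y))"
    proof (cases "x = y")
      case False
      show ?thesis unfolding Z_eq[OF xy False] by (simp only: algebra_simps)
    qed (use sym0D(2)[OF w xy(1)] in simp)
  qed
  also have "\<dots> = \<beta> * (\<Sum>x\<in>I. \<Sum>y\<in>I. w x y)
      + (\<alpha> - \<beta>) * ((\<Sum>x\<in>I. u x * (\<Sum>y\<in>I. w x y)) + (\<Sum>x\<in>I. \<Sum>y\<in>I. u y * w x y))
      + (\<zeta> - 2 * \<alpha> + \<beta>) * (\<Sum>x\<in>I. u x * (\<Sum>y\<in>I. u y * w x y))"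
    by (simp only: sum.distrib sum_distrib_left distrib_left)
  also have "(\<Sum>x\<in>I. \<Sum>y\<in>I. w x y) = 0" using sym0D(3)[OF w] by simp
  also have "(\<Sum>x\<in>I. u x * (\<Sum>y\<in>I. w x y)) = 0" using sym0D(3)[OF w] by simp
  also have "(\<Sum>x\<in>I. \<Sum>y\<in>I. u y * w x y) = (\<Sum>y\<in>I. u y * (\<Sum>x\<in>I. w x y))"
    unfolding sum_distrib_left by (rule sum.swap)
  also have "\<dots> = 0" using sym0D(4)[OF w] by simp
  also have "(\<Sum>x\<in>I. u x * (\<Sum>y\<in>I. u y * w x y)) = 2 * w a b"
  proof -
    have u_sum: "(\<Sum>x\<in>I. u x * g x) = g a + g b" for g
    proof -
      have "(\<Sum>x\<in>I. u x * g x) = (\<Sum>x\<in>{a, b}. g x)"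
        using I ab by (intro sum.mono_neutral_cong_right) (auto simp: u_def)
      then show ?thesis using ab by simp
    qed
    show ?thesis unfolding u_sum using sym0D(1)[OF w ab(1,2)] sym0D(2)[OF w] ab by simp
  qed
  also have "\<zeta> - 2 * \<alpha> + \<beta> = (1 + 2 / (n - 2) + 2 / ((n - 2) * (n - 3))) * Z a b"
    using n by (simp add: \<alpha>_def \<beta>_def \<zeta>_def field_simps)
  finally show ?thesis by simp
qed

definition pairing_const :: "'a set \<Rightarrow> 'a \<Rightarrow> 'a \<Rightarrow> 'a \<Rightarrow> 'a \<Rightarrow> real" where
  "pairing_const I a b c d = 2 * (1 + 2 / (real (card I) - 2)
      + 2 / ((real (card I) - 2) * (real (card I) - 3))) * (\<Sum>p\<in>perms I. fix2 a b c d p)"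

lemma pairing_const_pos:
  assumes I: "finite I" "card I \<ge> 4"
    and *: "a \<in> I" "b \<in> I" "c \<in> I" "d \<in> I" "a \<noteq> b" "c \<noteq> d"
  shows "pairing_const I a b c d > 0"
proof -
  \<comment> \<open>The witness first sends \<open>a\<close> to \<open>c\<close>, which takes
    \<open>b\<close> to \<open>b'\<close>, and then exchanges \<open>b'\<close> with
    \<open>d\<close>. The second step leaves \<open>c\<close> in place.\<close>
  define b' where "b' = Transposition.transpose a c b"
  define p where "p = Transposition.transpose d b' \<circ> Transposition.transpose a c"
  have "b' \<in> I" "b' \<noteq> c" using * by (auto simp: b'_def Transposition.transpose_def)
  then have "p permutes I" using * by (auto simp: p_def intro!: permutes_compose permutes_swap_id)
  moreover have "p a = c" "p b = d"
    using * \<open>b' \<noteq> c\<close> by (auto simp: p_def simp flip: b'_def)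
  ultimately have "(\<Sum>p\<in>perms I. fix2 a b c d p) > 0"
    using I(1) by (intro sum_pos2[of _ p]) (auto simp: fix2_def finite_permutations)
  moreover have "real (card I) - 2 > 0" "real (card I) - 3 > 0" using I(2) by simp_all
  ultimately show ?thesis unfolding pairing_const_def
    by (intro mult_pos_pos add_pos_pos divide_pos_pos) auto
qed

text \<open>Summing \<open>z (p x) (p y)\<close> over the permutations with \<open>p a = c\<close>
  and \<open>p b = d\<close> gives a matrix in S invariant under the transpositions fixing
  \<open>a\<close> and \<open>b\<close>. The previous sum formula then collapses the pairing with
  \<open>w\<close> to a single entry.\<close>

lemma ip_pairing_fix2:
  assumes I: "finite I" "card I \<ge> 4"
    and ab: "a \<in> I" "b \<in> I" "a \<noteq> b"
    and w: "sym0 I w" and z: "sym0 I z"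
  shows "ip I (pairing I w z) (fix2 a b c d) = pairing_const I a b c d * w a b * z c d"
proof -
  define Z where "Z x y = (\<Sum>p\<in>perms I. fix2 a b c d p * z (p x) (p y))" for x y
  have Z0: "sym0 I Z"
    unfolding sym0_def
  proof (intro conjI ballI)
    fix x y assume "x \<in> I" "y \<in> I"
    then show "Z x y = Z y x"
      unfolding Z_def using sym0D(1)[OF z] by (intro sum.cong refl) (auto simp: permutes_in_image)
  next
    fix x assume "x \<in> I"
    then show "Z x x = 0"
      unfolding Z_def using sym0D(2)[OF z] by (intro sum.neutral) (auto simp: permutes_in_image)
  next
    fix x assume x: "x \<in> I"
    have "(\<Sum>y\<in>I. Z x y) = (\<Sum>p\<in>perms I. \<Sum>y\<in>I. fix2 a b c d p * z (p x) (p y))"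
      unfolding Z_def by (rule sum.swap)
    also have "\<dots> = 0"
    proof (rule sum.neutral, rule ballI)
      fix p assume "p \<in> perms I"
      then have p: "p permutes I" by simp
      have "(\<Sum>y\<in>I. z (p x) (p y)) = (\<Sum>y\<in>I. z (p x) y)"
        using sum.permute[OF p, of "z (p x)"] by (simp add: o_def)
      also have "\<dots> = 0" using sym0D(3)[OF z] x p by (simp add: permutes_in_image)
      finally show "(\<Sum>y\<in>I. fix2 a b c d p * z (p x) (p y)) = 0"
        by (simp flip: sum_distrib_left)
    qed
    finally show "(\<Sum>y\<in>I. Z x y) = 0" .
  qed
  have inv: "Z (Transposition.transpose k l x) (Transposition.transpose k l y) = Z x y"
    if k: "k \<in> I - {a, b}" and l: "l \<in> I - {a, b}" for k l x y
  proof -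
    let ?t = "Transposition.transpose k l"
    have "?t a = a" "?t b = b" using k l by (metis DiffD2 insertCI transpose_apply_other)+
    then have "fix2 a b c d (p \<circ> ?t) = fix2 a b c d p" for p by (simp add: fix2_def)
    then show ?thesis
      using sum_perms_transpose_right[of k I l "\<lambda>p. fix2 a b c d p * z (p x) (p y)"] k l
      by (simp add: Z_def)
  qed
  have Zab: "Z a b = (\<Sum>p\<in>perms I. fix2 a b c d p) * z c d"
    unfolding Z_def sum_distrib_right by (intro sum.cong refl) (auto simp: fix2_def)
  have "ip I (pairing I w z) (fix2 a b c d)
      = (\<Sum>p\<in>perms I. \<Sum>x\<in>I. \<Sum>y\<in>I. w x y * (fix2 a b c d p * z (p x) (p y)))"
    by (simp add: inner_on_def pairing_def sum_distrib_right mult.assoc mult.commute[of "fix2 a b c d _"])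
  also have "\<dots> = (\<Sum>x\<in>I. \<Sum>p\<in>perms I. \<Sum>y\<in>I. w x y * (fix2 a b c d p * z (p x) (p y)))"
    by (rule sum.swap)
  also have "\<dots> = (\<Sum>x\<in>I. \<Sum>y\<in>I. \<Sum>p\<in>perms I. w x y * (fix2 a b c d p * z (p x) (p y)))"
    by (intro sum.cong refl sum.swap)
  also have "\<dots> = (\<Sum>x\<in>I. \<Sum>y\<in>I. w x y * Z x y)" by (simp add: Z_def sum_distrib_left)
  also have "\<dots> = pairing_const I a b c d * w a b * z c d"
  proof -
    have "(\<Sum>x\<in>I. \<Sum>y\<in>I. w x y * Z x y) = 2 * (1 + 2 / (real (card I) - 2)
        + 2 / ((real (card I) - 2) * (real (card I) - 3))) * Z a b * w a b"
      by (rule sum_sym0_stabiliser_invariant[OF I ab w Z0]) (rule inv)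
    then show ?thesis by (simp only: Zab pairing_const_def mult_ac)
  qed
  finally show ?thesis .
qed

text \<open>These entries are free coordinates on the matrices satisfying \<open>sym0\<close>: the sum of all
  entries outside row and column \<open>1\<close> vanishes, which determines the entry at \<open>(2, 3)\<close>, and then row
  \<open>k\<close> determines the one at \<open>(1, k)\<close>.\<close>
definition free_pairs :: "nat \<Rightarrow> (nat \<times> nat) set" where
  "free_pairs n = {(i, j). 2 \<le> i \<and> i < j \<and> j \<le> n \<and> (i, j) \<noteq> (2, 3)}"

lemma finite_free_pairs: "finite (free_pairs n)"
  by (rule finite_subset[of _ "{..n} \<times> {..n}"]) (auto simp: free_pairs_def)

text \<open>Passing from \<open>n\<close> to \<open>n + 1\<close> adds the \<open>n - 1\<close>
  pairs \<open>(i, n + 1)\<close> with \<open>2 \<le> i \<le> n\<close>. At \<open>n = 3\<close> the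
  only candidate is the excluded pair \<open>(2, 3)\<close>.\<close>

lemma card_free_pairs:
  assumes "n \<ge> 3"
  shows "real (card (free_pairs n)) = real n * (real n - 3) / 2"
  using assms
proof (induction n rule: nat_induct_at_least)
  case base
  have "free_pairs 3 = {}" by (auto simp: free_pairs_def)
  then show ?case by simp
next
  case (Suc n)
  have "free_pairs (Suc n) = free_pairs n \<union> (\<lambda>i. (i, Suc n)) ` {2..n}"
    using Suc.hyps by (auto simp: free_pairs_def le_Suc_eq)
  moreover have "free_pairs n \<inter> (\<lambda>i. (i, Suc n)) ` {2..n} = {}" by (auto simp: free_pairs_def)
  moreover have "card ((\<lambda>i. (i, Suc n)) ` {2..n}) = n - 1"
    by (subst card_image) (auto intro: inj_onI)
  ultimately have "card (free_pairs (Suc n)) = card (free_pairs n) + (n - 1)"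
    by (simp add: card_Un_disjoint finite_free_pairs)
  then show ?case using Suc by (simp add: of_nat_diff field_simps)
qed

definition sym_unit :: "'a \<Rightarrow> 'a \<Rightarrow> 'a \<Rightarrow> 'a \<Rightarrow> real" where
  "sym_unit i j a b = of_bool (a = i \<and> b = j) + of_bool (a = j \<and> b = i)"

text \<open>The corrections are supported outside the free coordinates.\<close>
definition free_basis :: "nat \<times> nat \<Rightarrow> nat \<Rightarrow> nat \<Rightarrow> real" where
  "free_basis q a b = sym_unit (fst q) (snd q) a b - sym_unit 2 3 a b
    - sym_unit 1 (fst q) a b - sym_unit 1 (snd q) a b + sym_unit 1 2 a b + sym_unit 1 3 a b"

lemma sym_unit_commute: "sym_unit i j a b = sym_unit i j b a"
  by (simp add: sym_unit_def conj_commute add.commute)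

lemma sum_sym_unit:
  assumes "finite I" "i \<in> I" "j \<in> I"
  shows "(\<Sum>b\<in>I. sym_unit i j a b) = of_bool (a = i) + of_bool (a = j)"
  using assms
  by (cases "a = i"; cases "a = j") (simp_all add: sym_unit_def sum.distrib of_bool_def flip: sum_distrib_left)

text \<open>The row sums of \<open>sym_unit i j\<close> are the indicator of \<open>i\<close> plus
  that of \<open>j\<close>; over the six units of \<open>free_basis\<close> all these indicators
  cancel.\<close>

lemma sym0_free_basis:
  assumes "n \<ge> 3" "q \<in> free_pairs n"
  shows "sym0 {1..n} (free_basis q)"
  unfolding sym0_def
proof (intro conjI ballI)
  fix a assume "a \<in> {1..n}"
  have "sym_unit i j a a = 0" if "i \<noteq> j" for i j using that by (auto simp: sym_unit_def)
  then show "free_basis q a a = 0" using assms by (auto simp: free_basis_def free_pairs_def)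
  show "(\<Sum>b\<in>{1..n}. free_basis q a b) = 0"
  proof -
    have "fst q \<in> {1..n}" "snd q \<in> {1..n}" "1 \<in> {1..n}" "2 \<in> {1..n}" "3 \<in> {1..n}"
      using assms by (auto simp: free_pairs_def)
    then show ?thesis by (simp only: free_basis_def sum.distrib sum_subtractf sum_sym_unit finite_atLeastAtMost)
  qed
next
  fix a b
  show "free_basis q a b = free_basis q b a"
    by (simp add: free_basis_def sym_unit_commute[of _ _ a b])
qed

lemma free_basis_dual:
  assumes "q \<in> free_pairs n" "r \<in> free_pairs n"
  shows "free_basis q (fst r) (snd r) = of_bool (q = r)"
proof -
  obtain i j k l where qr: "q = (i, j)" "r = (k, l)" by (metis surj_pair)
  have ij: "2 \<le> i" "i < j" and kl: "2 \<le> k" "k < l" "\<not> (k = 2 \<and> l = 3)"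
    using assms by (auto simp: qr free_pairs_def)
  have "sym_unit 1 x k l = 0" for x using kl by (simp add: sym_unit_def)
  moreover have "sym_unit 2 3 k l = 0" using kl by (auto simp: sym_unit_def)
  moreover have "sym_unit i j k l = of_bool (q = r)" using ij kl by (auto simp: sym_unit_def qr)
  ultimately show ?thesis by (simp add: free_basis_def qr)
qed

text \<open>In a row \<open>i \<ge> 4\<close> only the entry in column \<open>1\<close> is left, so
  it vanishes. Rows \<open>1\<close>, \<open>2\<close>, \<open>3\<close> then say that the entries
  at \<open>(1, 2)\<close>, \<open>(1, 3)\<close> and \<open>(2, 3)\<close> have pairwise sums
  zero.\<close>

lemma sym0_eq_0:
  assumes n: "n \<ge> 3" and w: "sym0 {1..n} w"
    and 0: "\<And>q. q \<in> free_pairs n \<Longrightarrow> w (fst q) (snd q) = 0"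
    and ab: "a \<in> {1..n}" "b \<in> {1..n}"
  shows "w a b = 0"
proof -
  note sym = sym0D(1)[OF w] and diag = sym0D(2)[OF w] and row = sym0D(3)[OF w]
  have free: "w i j = 0" if ij: "i \<in> {2..n}" "j \<in> {2..n}" and ne: "\<not> (i = 2 \<and> j = 3)" "\<not> (i = 3 \<and> j = 2)" for i j
  proof -
    consider "i = j" | "(i, j) \<in> free_pairs n" | "(j, i) \<in> free_pairs n"
      using ij ne by (cases i j rule: linorder_cases) (auto simp: free_pairs_def)
    then show ?thesis using 0[of "(i, j)"] 0[of "(j, i)"] sym[of i j] diag[of i] ij by cases auto
  qed
  have one: "w i 1 = 0" if i: "i \<in> {4..n}" for i
  proof -
    have "w i b = 0" if "b \<in> {1..n} - {1}" for b
      using free[of i b] diag[of i] that i by auto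
    then have "(\<Sum>b\<in>{1..n}. w i b) = (\<Sum>b\<in>{1}. w i b)"
      using i n by (intro sum.mono_neutral_right) auto
    then show ?thesis using row[of i] i by simp
  qed
  have "w 2 1 + w 2 3 = 0"
  proof -
    have "w 2 b = 0" if "b \<in> {1..n} - {1, 3}" for b
      using free[of 2 b] diag[of 2] that n by auto
    then have "(\<Sum>b\<in>{1..n}. w 2 b) = (\<Sum>b\<in>{1, 3}. w 2 b)"
      using n by (intro sum.mono_neutral_right) auto
    then show ?thesis using row[of 2] n by simp
  qed
  moreover have "w 3 1 + w 3 2 = 0"
  proof -
    have "w 3 b = 0" if "b \<in> {1..n} - {1, 2}" for b
      using free[of 3 b] diag[of 3] that n by auto
    then have "(\<Sum>b\<in>{1..n}. w 3 b) = (\<Sum>b\<in>{1, 2}. w 3 b)"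
      using n by (intro sum.mono_neutral_right) auto
    then show ?thesis using row[of 3] n by simp
  qed
  moreover have "w 1 2 + w 1 3 = 0"
  proof -
    have "w 1 b = 0" if "b \<in> {1..n}" "b \<noteq> 2" "b \<noteq> 3" for b
      using that one[of b] sym[of 1 b] diag[of 1] n by (cases "b = 1") auto
    then have "(\<Sum>b\<in>{1..n}. w 1 b) = (\<Sum>b\<in>{2, 3}. w 1 b)"
      using n by (intro sum.mono_neutral_right) auto
    then show ?thesis using row[of 1] n by simp
  qed
  moreover have "w 2 1 = w 1 2" "w 3 1 = w 1 3" "w 3 2 = w 2 3" using sym[of 2 1] sym[of 3 1] sym[of 3 2] n by simp_all
  ultimately have special: "w 1 2 = 0" "w 1 3 = 0" "w 2 3 = 0" by linarith+
  consider "a = b" | "a = 1" "b \<in> {2..n}" | "b = 1" "a \<in> {2..n}" | "a \<in> {2..n}" "b \<in> {2..n}"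
    using ab unfolding atLeastAtMost_iff by linarith
  then show ?thesis
  proof cases
    case 2
    then have "b = 2 \<or> b = 3 \<or> b \<in> {4..n}" unfolding atLeastAtMost_iff by linarith
    moreover have "w 1 b = w b 1" using 2 by (intro sym) auto
    ultimately show ?thesis using special one[of b] 2 by metis
  next
    case 3
    then have "a = 2 \<or> a = 3 \<or> a \<in> {4..n}" unfolding atLeastAtMost_iff by linarith
    moreover have "w 1 a = w a 1" using 3 by (intro sym) auto
    ultimately show ?thesis using special one[of a] 3 by metis
  next
    case 4
    have "w 3 2 = 0" using special sym[of 3 2] n by simp
    then show ?thesis using special free[OF 4] by blast
  qed (use diag[OF ab(1)] in simp)
qed

section \<open>The adjacency matrix\<close>

lemma sum_symmetric_pairs:
  fixes H :: "'a :: linorder \<Rightarrow> 'a \<Rightarrow> real"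
  assumes I: "finite I" and H: "\<And>i j. H i j = H j i"
  shows "(\<Sum>i\<in>I. \<Sum>j\<in>I. H i j) = (\<Sum>i\<in>I. H i i) + 2 * (\<Sum>(i, j) | i \<in> I \<and> j \<in> I \<and> i < j. H i j)"
proof -
  have lt: "(\<Sum>i\<in>I. \<Sum>j\<in>I. of_bool (i < j) * H i j) = (\<Sum>(i, j) | i \<in> I \<and> j \<in> I \<and> i < j. H i j)"
    unfolding sum.cartesian_product using I
    by (intro sum.mono_neutral_cong_right) auto
  have "(\<Sum>i\<in>I. \<Sum>j\<in>I. of_bool (j < i) * H i j) = (\<Sum>j\<in>I. \<Sum>i\<in>I. of_bool (j < i) * H i j)"
    by (rule sum.swap)
  also have "\<dots> = (\<Sum>i\<in>I. \<Sum>j\<in>I. of_bool (i < j) * H i j)"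
    using H by (intro sum.cong refl) (metis)
  finally have gt: "(\<Sum>i\<in>I. \<Sum>j\<in>I. of_bool (j < i) * H i j)
    = (\<Sum>(i, j) | i \<in> I \<and> j \<in> I \<and> i < j. H i j)" unfolding lt .
  have "(\<Sum>i\<in>I. \<Sum>j\<in>I. H i j) = (\<Sum>i\<in>I. \<Sum>j\<in>I.
      (if i = j then H i j else 0) + of_bool (i < j) * H i j + of_bool (j < i) * H i j)"
    by (intro sum.cong refl) auto
  also have "\<dots> = (\<Sum>i\<in>I. H i i) + 2 * (\<Sum>(i, j) | i \<in> I \<and> j \<in> I \<and> i < j. H i j)"
    unfolding sum.distrib lt gt using I by simp
  finally show ?thesis .
qed

text \<open>A transposition is determined by its support, so the pairs \<open>i < j\<close>
  enumerate all of them without repetition.\<close>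

lemma sum_transpositions:
  "(\<Sum>s\<in>transpositions n. G s)
    = (\<Sum>(i, j) | i \<in> {1..n} \<and> j \<in> {1..n} \<and> i < j. G (Transposition.transpose i j))"
proof -
  let ?L = "{(i, j). i \<in> {1..n} \<and> j \<in> {1..n} \<and> i < j}"
  let ?t = "\<lambda>(i, j). Transposition.transpose i j :: nat \<Rightarrow> nat"
  have "transpositions n = ?t ` ?L"
  proof (intro subset_antisym subsetI)
    fix s assume "s \<in> transpositions n"
    then obtain a b where ab: "a \<in> {1..n}" "b \<in> {1..n}" "a \<noteq> b" "s = Transposition.transpose a b"
      by (auto simp: transpositions_def)
    then have "s = ?t (min a b, max a b)" "(min a b, max a b) \<in> ?L"
      by (auto simp: min_def max_def transpose_commute)
    then show "s \<in> ?t ` ?L" by blast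
  qed (force simp: transpositions_def)
  moreover have "inj_on ?t ?L"
  proof (rule inj_onI, clarify)
    fix i j k l :: nat
    assume lt: "i < j" "k < l" and eq: "Transposition.transpose i j = Transposition.transpose k l"
    have supp: "{x. Transposition.transpose a b x \<noteq> x} = {a, b}" if "a < b" for a b :: nat
      using that by (auto simp: Transposition.transpose_def)
    have "{i, j} = {k, l}" using supp[OF lt(1)] supp[OF lt(2)] eq by simp
    then show "i = k \<and> j = l" using lt by (auto simp: doubleton_eq_iff)
  qed
  ultimately show ?thesis by (simp add: sum.reindex case_prod_unfold)
qed

text \<open>Each transposition arises from two ordered pairs. Hence a value \<open>\<lambda>\<close>
  of \<open>lap\<close> corresponds to \<open>(n (n - 1) - \<lambda>) / 2\<close> for the adjacency
  matrix, and \<open>0\<close>, \<open>2 n\<close>, \<open>4 n - 4\<close> become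
  \<open>n (n - 1) / 2\<close>, \<open>n (n - 3) / 2\<close>,
  \<open>(n - 1) (n - 4) / 2\<close>.\<close>

lemma lap_eq_sum_transpositions:
  "lap {1..n} f p = real n * (real n - 1) * f p - 2 * (\<Sum>s\<in>transpositions n. f (p \<circ> s))"
proof -
  let ?L = "{(i, j). i \<in> {1..n} \<and> j \<in> {1..n} \<and> i < j}"
  \<comment> \<open>The number of pairs \<open>i < j\<close> comes from applying the symmetric
    summation to the constant \<open>1\<close>.\<close>
  have "real n * real n = real n + 2 * real (card ?L)"
    using sum_symmetric_pairs[of "{1..n}" "\<lambda>_ _. 1"] by (simp add: case_prod_unfold)
  then have card: "2 * real (card ?L) = real n * (real n - 1)" by (simp add: algebra_simps)
  have "lap {1..n} f p = 2 * (\<Sum>(i, j)\<in>?L. f p - f (p \<circ> Transposition.transpose i j))"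
    unfolding lap_def
    by (subst sum_symmetric_pairs) (auto simp: transpose_commute)
  also have "\<dots> = 2 * real (card ?L) * f p - 2 * (\<Sum>s\<in>transpositions n. f (p \<circ> s))"
    by (simp add: sum_transpositions case_prod_unfold sum_subtractf)
  finally show ?thesis unfolding card .
qed

lemma pverts_transposition_graph: "pverts (transposition_graph n) = perms {1..n}"
  by (simp add: transposition_graph_def cayley_graph_def sym_group_def)

lemma transpositions_subset_perms: "transpositions n \<subseteq> perms {1..n}"
  by (auto simp: transpositions_def intro: permutes_swap_id)

lemma parcs_transposition_graph:
  assumes "p permutes {1..n}"
  shows "(p, h) \<in> parcs (transposition_graph n) \<longleftrightarrow> h \<in> (\<lambda>s. p \<circ> s) ` transpositions n"
  using assms transpositions_subset_perms[of n]
  by (auto simp: transposition_graph_def cayley_graph_def sym_group_def intro: permutes_compose)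

lemma sum_transposition_neighbours:
  fixes f :: "(nat \<Rightarrow> nat) \<Rightarrow> real"
  assumes p: "p permutes {1..n}"
  shows "(\<Sum>h\<in>perms {1..n}. (if (p, h) \<in> parcs (transposition_graph n) then 1 else 0) * f h)
    = (\<Sum>s\<in>transpositions n. f (p \<circ> s))"
proof -
  have "(\<Sum>h\<in>perms {1..n}. (if (p, h) \<in> parcs (transposition_graph n) then 1 else 0) * f h)
      = (\<Sum>h\<in>(\<lambda>s. p \<circ> s) ` transpositions n. f h)"
    using p transpositions_subset_perms[of n]
    by (intro sum.mono_neutral_cong_right)
      (auto simp: parcs_transposition_graph finite_permutations intro: permutes_compose)
  also have "\<dots> = (\<Sum>s\<in>transpositions n. f (p \<circ> s))"
    using inj_on_subset[OF fun.inj_map[OF permutes_inj[OF p]]]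
    by (subst sum.reindex) auto
  finally show ?thesis .
qed

lemma parcs_transposition_graph_sym:
  assumes "(g, h) \<in> parcs (transposition_graph n)"
  shows "(h, g) \<in> parcs (transposition_graph n)"
proof -
  from assms obtain s where s: "g permutes {1..n}" "h permutes {1..n}" "s \<in> transpositions n" "h = g \<circ> s"
    by (auto simp: transposition_graph_def cayley_graph_def sym_group_def)
  then have "g = h \<circ> s" by (auto simp: transpositions_def o_assoc[symmetric])
  then show ?thesis using s by (auto simp: transposition_graph_def cayley_graph_def sym_group_def)
qed

section \<open>Spectrum and multiplicity for a fixed enumeration of the vertices\<close>

context
  fixes n :: nat and e :: "nat \<Rightarrow> nat \<Rightarrow> nat" and N :: nat and A :: "real mat"
  assumes n: "n \<ge> 4" and enum: "vertex_enumeration (transposition_graph n) e"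
  defines "N \<equiv> card (perms {1..n})" and "A \<equiv> adjacency_matrix (transposition_graph n) e"
begin

lemma bij_e: "bij_betw e {..<N} (perms {1..n})"
  using enum by (simp add: vertex_enumeration_def pverts_transposition_graph N_def)

lemma e_permutes: "i < N \<Longrightarrow> e i permutes {1..n}"
  using bij_betwE[OF bij_e] by simp

lemma obtain_index:
  assumes "p permutes {1..n}"
  obtains i where "i < N" "p = e i"
  using bij_betw_imp_surj_on[OF bij_e] assms by (metis imageE lessThan_iff mem_Collect_eq)

lemma A_carrier: "A \<in> carrier_mat N N"
  by (simp add: A_def adjacency_matrix_def N_def pverts_transposition_graph)

lemma A_entry:
  "i < N \<Longrightarrow> j < N \<Longrightarrow> A $$ (i, j) = (if (e i, e j) \<in> parcs (transposition_graph n) then 1 else 0)"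
  by (simp add: A_def adjacency_matrix_def N_def pverts_transposition_graph)

lemma A_symmetric: "A\<^sup>T = A"
  using A_carrier parcs_transposition_graph_sym[of _ _ n] by (intro eq_matI) (auto simp: A_entry)

lemma A_mult_vec:
  "A *\<^sub>v vec N (\<lambda>i. f (e i))
    = vec N (\<lambda>i. (real n * (real n - 1) * f (e i) - lap {1..n} f (e i)) / 2)"
proof (rule eq_vecI)
  fix i assume "i < dim_vec (vec N (\<lambda>i. (real n * (real n - 1) * f (e i) - lap {1..n} f (e i)) / 2))"
  then have i: "i < N" by simp
  have "(A *\<^sub>v vec N (\<lambda>i. f (e i))) $ i
      = (\<Sum>j<N. (if (e i, e j) \<in> parcs (transposition_graph n) then 1 else 0) * f (e j))"
    using A_carrier i by (auto simp: scalar_prod_def A_entry lessThan_atLeast0 intro!: sum.cong)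
  also have "\<dots> = (\<Sum>h\<in>perms {1..n}. (if (e i, h) \<in> parcs (transposition_graph n) then 1 else 0) * f h)"
    by (rule sum.reindex_bij_betw[OF bij_e])
  also have "\<dots> = (\<Sum>s\<in>transpositions n. f (e i \<circ> s))"
    by (rule sum_transposition_neighbours[OF e_permutes[OF i]])
  finally show "(A *\<^sub>v vec N (\<lambda>i. f (e i))) $ i
      = vec N (\<lambda>i. (real n * (real n - 1) * f (e i) - lap {1..n} f (e i)) / 2) $ i"
    using i by (simp add: lap_eq_sum_transpositions del: One_nat_def)
qed (use A_carrier in auto)

lemma vec_as_function:
  assumes "v \<in> carrier_vec N"
  obtains f where "v = vec N (\<lambda>i. f (e i))"
proof (rule that)
  show "v = vec N (\<lambda>i. (\<lambda>p. v $ inv_into {..<N} e p) (e i))"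
    using assms bij_betw_imp_inj_on[OF bij_e] by (intro eq_vecI) auto
qed

lemma A_eigen_iff:
  "A *\<^sub>v vec N (\<lambda>i. f (e i)) = x \<cdot>\<^sub>v vec N (\<lambda>i. f (e i)) \<longleftrightarrow>
    (\<forall>p. p permutes {1..n} \<longrightarrow> lap {1..n} f p = (real n * (real n - 1) - 2 * x) * f p)"
proof -
  have "A *\<^sub>v vec N (\<lambda>i. f (e i)) = x \<cdot>\<^sub>v vec N (\<lambda>i. f (e i)) \<longleftrightarrow>
    (\<forall>i<N. (real n * (real n - 1) * f (e i) - lap {1..n} f (e i)) / 2 = x * f (e i))"
    unfolding A_mult_vec by (auto simp: vec_eq_iff)
  also have "\<dots> \<longleftrightarrow> (\<forall>i<N. lap {1..n} f (e i) = (real n * (real n - 1) - 2 * x) * f (e i))"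
    by (auto simp: field_simps)
  also have "\<dots> \<longleftrightarrow> (\<forall>p. p permutes {1..n} \<longrightarrow>
      lap {1..n} f p = (real n * (real n - 1) - 2 * x) * f p)"
    by (metis obtain_index e_permutes)
  finally show ?thesis .
qed

lemma in_spectrum_A_iff:
  "x \<in> spectrum A \<longleftrightarrow> (\<exists>f. (\<exists>p. p permutes {1..n} \<and> f p \<noteq> 0) \<and>
    (\<forall>p. p permutes {1..n} \<longrightarrow> lap {1..n} f p = (real n * (real n - 1) - 2 * x) * f p))"
proof -
  have nz: "vec N (\<lambda>i. f (e i)) \<noteq> 0\<^sub>v N \<longleftrightarrow> (\<exists>p. p permutes {1..n} \<and> f p \<noteq> 0)"
    for f :: "(nat \<Rightarrow> nat) \<Rightarrow> real"
    unfolding vec_eq_iff by (simp del: One_nat_def) (metis e_permutes obtain_index)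
  have "x \<in> spectrum A \<longleftrightarrow> (\<exists>v. v \<in> carrier_vec N \<and> v \<noteq> 0\<^sub>v N \<and> A *\<^sub>v v = x \<cdot>\<^sub>v v)"
    using A_carrier by (auto simp: spectrum_def eigenvalue_def eigenvector_def)
  also have "\<dots> \<longleftrightarrow> (\<exists>f. vec N (\<lambda>i. f (e i)) \<noteq> 0\<^sub>v N \<and>
      A *\<^sub>v vec N (\<lambda>i. f (e i)) = x \<cdot>\<^sub>v vec N (\<lambda>i. f (e i)))"
    by (metis vec_as_function vec_carrier)
  finally show ?thesis unfolding nz A_eigen_iff .
qed

text \<open>\<open>sym0_eq_0\<close> is applied twice: first in the points, with free values held
  fixed, and then in the values, with arbitrary distinct points held fixed.\<close>

lemma lap_eigenfunction_eq_0:
  assumes eig: "\<And>p. p permutes {1..n} \<Longrightarrow> lap {1..n} f p = (4 * real n - 4) * f p"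
    and 0: "\<And>q r. q \<in> free_pairs n \<Longrightarrow> r \<in> free_pairs n \<Longrightarrow>
      ip {1..n} f (fix2 (fst q) (snd q) (fst r) (snd r)) = 0"
    and p: "p permutes {1..n}"
  shows "f p = 0"
proof -
  have I: "finite {1..n}" "card {1..n} \<ge> 3" using n by auto
  have eig': "lap {1..n} f p = (4 * real (card {1..n}) - 4) * f p" if "p permutes {1..n}" for p
    using eig[OF that] by simp
  have source: "ip {1..n} f (fix2 a b (fst r) (snd r)) = 0"
    if "a \<in> {1..n}" "b \<in> {1..n}" and r: "r \<in> free_pairs n" for a b r
  proof -
    have "fst r \<in> {1..n}" "snd r \<in> {1..n}" "fst r \<noteq> snd r" using r by (auto simp: free_pairs_def)
    from eigenfunction_sym0_source[OF I eig' this]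
    show ?thesis by (rule sym0_eq_0[rotated]) (use n 0 r that in auto)
  qed
  show ?thesis
  proof (rule eigenfunction_eq_0[OF I eig' _ p])
    fix a b c d assume *: "a \<in> {1..n}" "b \<in> {1..n}" "c \<in> {1..n}" "d \<in> {1..n}" "a \<noteq> b" "c \<noteq> d"
    from eigenfunction_sym0_target[OF I eig' *(1,2,5)]
    show "ip {1..n} f (fix2 a b c d) = 0"
      by (rule sym0_eq_0[rotated]) (use n source * in auto)
  qed
qed

text \<open>\<open>order_char_poly_symmetric\<close> is applied with \<open>s = 1\<close>. The
  columns of \<open>P\<close> are the eigenfunctions built from two basis elements of S; the rows of
  \<open>Z\<close> are the \<open>fix2\<close> indicators at two free pairs, divided by
  \<open>\<gamma>\<close> to make them dual to the columns.\<close>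

lemma order_third_eigenvalue:
  "order ((real n - 1) * (real n - 4) / 2) (char_poly A) = card (free_pairs n) ^ 2"
proof -
  let ?I = "{1..n}"
  have I: "finite ?I" "card ?I \<ge> 4" using n by auto
  define m where "m = card (free_pairs n \<times> free_pairs n)"
  obtain idx where idx: "bij_betw idx {0..<m} (free_pairs n \<times> free_pairs n)"
    unfolding m_def
    using ex_bij_betw_nat_finite[OF finite_cartesian_product[OF finite_free_pairs finite_free_pairs]] ..
  define q r where "q k = fst (idx k)" and "r k = snd (idx k)" for k
  have qr: "q k \<in> free_pairs n" "r k \<in> free_pairs n" if "k < m" for k
    using bij_betwE[OF idx] that by (auto simp: q_def r_def mem_Times_iff)
  have qr_inj: "q k = q l \<and> r k = r l \<longleftrightarrow> k = l" if "k < m" "l < m" for k l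
    using bij_betw_imp_inj_on[OF idx] that by (auto simp: q_def r_def inj_on_def prod_eq_iff)
  have qr_surj: "\<exists>k<m. q k = x \<and> r k = y" if "x \<in> free_pairs n" "y \<in> free_pairs n" for x y
  proof -
    have "(x, y) \<in> idx ` {0..<m}" using bij_betw_imp_surj_on[OF idx] that by simp
    then obtain k where "k < m" "idx k = (x, y)" by auto
    then show ?thesis by (auto simp: q_def r_def)
  qed
  define \<phi> where "\<phi> k = fix2 (fst (q k)) (snd (q k)) (fst (r k)) (snd (r k))" for k
  define \<gamma> where "\<gamma> k = pairing_const ?I (fst (q k)) (snd (q k)) (fst (r k)) (snd (r k))" for k
  define F where "F k = pairing ?I (free_basis (q k)) (free_basis (r k))" for k
  define P where "P = mat N m (\<lambda>(i, k). F k (e i))"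
  define Z where "Z = mat m N (\<lambda>(k, i). \<phi> k (e i) / \<gamma> k)"
  have P: "P \<in> carrier_mat N m" and Z: "Z \<in> carrier_mat m N" by (simp_all add: P_def Z_def)
  have ends: "fst x \<in> ?I" "snd x \<in> ?I" "fst x \<noteq> snd x" if "x \<in> free_pairs n" for x
    using that by (auto simp: free_pairs_def)
  have \<gamma>: "\<gamma> k > 0" if "k < m" for k
    unfolding \<gamma>_def using pairing_const_pos[OF I] ends qr[OF that] by simp
  have sum_e: "(\<Sum>i<N. \<phi> k (e i) / \<gamma> k * f (e i)) = ip ?I f (\<phi> k) / \<gamma> k" for k f
    using sum.reindex_bij_betw[OF bij_e, of "\<lambda>p. \<phi> k p / \<gamma> k * f p"]
    by (simp add: inner_on_def sum_divide_distrib mult.commute)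
  have dual: "ip ?I (F l) (\<phi> k) = \<gamma> k * of_bool (k = l)" if "k < m" "l < m" for k l
  proof -
    have "ip ?I (F l) (\<phi> k) = \<gamma> k * free_basis (q l) (fst (q k)) (snd (q k))
        * free_basis (r l) (fst (r k)) (snd (r k))"
      unfolding F_def \<phi>_def \<gamma>_def using n qr[OF that(1)] qr[OF that(2)] ends
      by (intro ip_pairing_fix2[OF I] sym0_free_basis) auto
    also have "\<dots> = \<gamma> k * (of_bool (q l = q k) * of_bool (r l = r k))"
      using qr[OF that(1)] qr[OF that(2)] by (simp add: free_basis_dual)
    also have "of_bool (q l = q k) * of_bool (r l = r k) = (of_bool (k = l) :: real)"
      unfolding of_bool_conj[symmetric] qr_inj[OF that(2,1)] by (cases "k = l") auto
    finally show ?thesis .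
  qed
  have "order ((real n - 1) * (real n - 4) / 2) (char_poly A) = m"
  proof (rule order_char_poly_symmetric[OF A_carrier A_symmetric P Z, where s = 1])
    show "A * P = ((real n - 1) * (real n - 4) / 2) \<cdot>\<^sub>m P"
    proof (rule eq_matI)
      fix i k assume "i < dim_row (((real n - 1) * (real n - 4) / 2) \<cdot>\<^sub>m P)"
        "k < dim_col (((real n - 1) * (real n - 4) / 2) \<cdot>\<^sub>m P)"
      then have ik: "i < N" "k < m" using P by auto
      have colP: "col P k = vec N (\<lambda>i. F k (e i))" using ik by (auto simp: P_def)
      have "(A * P) $$ (i, k) = (A *\<^sub>v col P k) $ i" using A_carrier P ik by simp
      also have "\<dots> = (real n * (real n - 1) * F k (e i) - (4 * real n - 4) * F k (e i)) / 2"
        unfolding colP A_mult_vec using ik n qr[OF ik(2)]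
        by (simp add: F_def lap_pairing sym0_free_basis del: One_nat_def)
      also have "\<dots> = (real n - 1) * (real n - 4) / 2 * F k (e i)" by (simp add: field_simps)
      finally show "(A * P) $$ (i, k) = (((real n - 1) * (real n - 4) / 2) \<cdot>\<^sub>m P) $$ (i, k)"
        using ik by (simp add: P_def)
    qed (use A_carrier P in auto)
    show "Z * P = 1 \<cdot>\<^sub>m 1\<^sub>m m"
    proof (rule eq_matI)
      fix k l assume "k < dim_row (1 \<cdot>\<^sub>m 1\<^sub>m m :: real mat)" "l < dim_col (1 \<cdot>\<^sub>m 1\<^sub>m m :: real mat)"
      then have kl: "k < m" "l < m" by auto
      have "(Z * P) $$ (k, l) = (\<Sum>i<N. \<phi> k (e i) / \<gamma> k * F l (e i))"
        using kl by (simp add: Z_def P_def scalar_prod_def lessThan_atLeast0)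
      also have "\<dots> = of_bool (k = l)" unfolding sum_e dual[OF kl] using \<gamma>[OF kl(1)] by simp
      finally show "(Z * P) $$ (k, l) = (1 \<cdot>\<^sub>m 1\<^sub>m m) $$ (k, l)" using kl by simp
    qed (use Z P in auto)
    show "v = 0\<^sub>v N" if v: "v \<in> carrier_vec N" and Av: "A *\<^sub>v v = ((real n - 1) * (real n - 4) / 2) \<cdot>\<^sub>v v"
      and Zv: "Z *\<^sub>v v = 0\<^sub>v m" for v
    proof -
      obtain f where f: "v = vec N (\<lambda>i. f (e i))" using vec_as_function[OF v] .
      have eig: "lap ?I f p = (4 * real n - 4) * f p" if "p permutes ?I" for p
      proof -
        have "lap ?I f p = (real n * (real n - 1) - 2 * ((real n - 1) * (real n - 4) / 2)) * f p"
          using Av that unfolding f A_eigen_iff by blast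
        also have "real n * (real n - 1) - 2 * ((real n - 1) * (real n - 4) / 2) = 4 * real n - 4"
          by (simp add: field_simps)
        finally show ?thesis .
      qed
      have "ip ?I f (\<phi> k) = 0" if k: "k < m" for k
      proof -
        have "0 = (Z *\<^sub>v v) $ k" using Zv k by simp
        also have "\<dots> = (\<Sum>i<N. \<phi> k (e i) / \<gamma> k * f (e i))"
          using k by (simp add: Z_def f scalar_prod_def lessThan_atLeast0)
        finally show ?thesis unfolding sum_e using \<gamma>[OF k] by simp
      qed
      then have "ip ?I f (fix2 (fst x) (snd x) (fst y) (snd y)) = 0"
        if "x \<in> free_pairs n" "y \<in> free_pairs n" for x y
        using qr_surj[OF that] by (auto simp: \<phi>_def)
      from lap_eigenfunction_eq_0[OF eig this] have "f p = 0" if "p permutes ?I" for p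
        using that by blast
      then show ?thesis unfolding f using e_permutes by (intro eq_vecI) auto
    qed
  qed simp
  then show ?thesis by (simp add: m_def card_cartesian_product power2_eq_square)
qed

text \<open>\<open>y\<close> lies above the threshold exactly when \<open>n (n - 1) - 2 y\<close>
  lies below \<open>4 n - 4\<close>, so \<open>lap_eigenvalue_cases\<close> leaves only
  \<open>0\<close> and \<open>2 n\<close> as values of \<open>lap\<close>. Explicit eigenfunctions
  realise both.\<close>

lemma top_spectrum_A:
  "{y \<in> spectrum A. (real n - 1) * (real n - 4) / 2 < y}
    = {real n * (real n - 1) / 2, real n * (real n - 3) / 2}"
proof (intro subset_antisym subsetI)
  fix y assume "y \<in> {y \<in> spectrum A. (real n - 1) * (real n - 4) / 2 < y}"
  then obtain f where nz: "\<exists>p. p permutes {1..n} \<and> f p \<noteq> 0"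
    and eig: "\<And>p. p permutes {1..n} \<Longrightarrow> lap {1..n} f p = (real n * (real n - 1) - 2 * y) * f p"
    and y: "(real n - 1) * (real n - 4) / 2 < y"
    by (auto simp: in_spectrum_A_iff)
  have lt: "real n * (real n - 1) - 2 * y < 4 * real n - 4" using y by (simp add: field_simps)
  then have "real n * (real n - 1) - 2 * y = 0 \<or> real n * (real n - 1) - 2 * y = 2 * real n"
    using lap_eigenvalue_cases[OF _ _ eig nz] n by auto
  then show "y \<in> {real n * (real n - 1) / 2, real n * (real n - 3) / 2}"
    by (auto simp: field_simps)
next
  fix y assume y: "y \<in> {real n * (real n - 1) / 2, real n * (real n - 3) / 2}"
  have "real n * (real n - 1) / 2 \<in> spectrum A"
    unfolding in_spectrum_A_iff
    by (intro exI[of _ "\<lambda>_. 1"]) (auto simp: lap_def intro: permutes_id)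
  moreover have "real n * (real n - 3) / 2 \<in> spectrum A"
    unfolding in_spectrum_A_iff
  \<comment> \<open>In a difference of two \<open>fix1\<close> indicators the constant terms of
    \<open>lap_fix1\<close> cancel, which leaves the eigenvalue \<open>2 n\<close>. At the identity
    the difference is \<open>1\<close>.\<close>
  proof (intro exI[of _ "\<lambda>p. fix1 1 1 p - fix1 2 1 p"] conjI allI impI)
    show "\<exists>p. p permutes {1..n} \<and> fix1 1 1 p - fix1 2 1 p \<noteq> 0"
      by (intro exI[of _ id]) (simp add: permutes_id fix1_def)
    fix p assume p: "p permutes {1..n}"
    show "lap {1..n} (\<lambda>p. fix1 1 1 p - fix1 2 1 p) p
        = (real n * (real n - 1) - 2 * (real n * (real n - 3) / 2)) * (fix1 1 1 p - fix1 2 1 p)"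
    proof -
      have *: "real n * (real n - 1) - 2 * (real n * (real n - 3) / 2) = 2 * real n"
        by (simp add: field_simps)
      show ?thesis unfolding * using n p by (simp add: lap_diff lap_fix1 algebra_simps)
    qed
  qed
  moreover have "(real n - 1) * (real n - 4) / 2 < real n * (real n - 1) / 2"
    "(real n - 1) * (real n - 4) / 2 < real n * (real n - 3) / 2"
    using n by (simp_all add: field_simps)
  ultimately show "y \<in> {y \<in> spectrum A. (real n - 1) * (real n - 4) / 2 < y}" using y by blast
qed

text \<open>The multiplicity is positive because \<open>(2, 4)\<close> is a free pair as soon as
  \<open>n \<ge> 4\<close>.\<close>

lemma third_eigenvalue_in_spectrum: "(real n - 1) * (real n - 4) / 2 \<in> spectrum A"
proof -
  have "(2, 4) \<in> free_pairs n" using n by (simp add: free_pairs_def)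
  then have "order ((real n - 1) * (real n - 4) / 2) (char_poly A) \<noteq> 0"
    using finite_free_pairs[of n] by (auto simp: order_third_eigenvalue card_eq_0_iff)
  then have "poly (char_poly A) ((real n - 1) * (real n - 4) / 2) = 0"
    using order_root by blast
  then show ?thesis using eigenvalue_root_char_poly[OF A_carrier] by (simp add: spectrum_def)
qed

end

theorem theorem4:
  fixes n :: nat and e :: "nat \<Rightarrow> nat \<Rightarrow> nat"
  assumes "n \<ge> 4"
    and "vertex_enumeration (transposition_graph n) e"
  shows "is_kth_largest 3 (spectrum (adjacency_matrix (transposition_graph n) e))
           ((real n - 1) * (real n - 4) / 2) \<and>
         real (eigenvalue_multiplicity (adjacency_matrix (transposition_graph n) e)
           ((real n - 1) * (real n - 4) / 2)) = (real n * (real n - 3) / 2)\<^sup>2"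
proof
  \<comment> \<open>The two larger eigenvalues must be distinct for the position to be exactly
    \<open>3\<close>.\<close>
  have "real n * (real n - 1) / 2 \<noteq> real n * (real n - 3) / 2" using assms(1) by simp
  then show "is_kth_largest 3 (spectrum (adjacency_matrix (transposition_graph n) e))
      ((real n - 1) * (real n - 4) / 2)"
    unfolding is_kth_largest_def top_spectrum_A[OF assms]
    using third_eigenvalue_in_spectrum[OF assms] by simp
  show "real (eigenvalue_multiplicity (adjacency_matrix (transposition_graph n) e)
      ((real n - 1) * (real n - 4) / 2)) = (real n * (real n - 3) / 2)\<^sup>2"
    unfolding eigenvalue_multiplicity_def order_third_eigenvalue[OF assms]
    using card_free_pairs[of n] assms(1) by simp
qed

end
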